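(* Let $\alpha,\beta>0$ and let $1\le p,q\le\infty$ be such that $\min(p,q)$ is finite. For $f\in L^1(\mathbb{R}^2,\mathbb{H})\cap L^2(\mathbb{R}^2,\mathbb{H})$ consider the following two conditions: (i) $\int_{\mathbb{R}^2}\left(|f(\mathbf{x})|_Q\,e^{\alpha|\mathbf{x}|^2}\right)^p d\mathbf{x}<\infty$; (ii) $\int_{\mathbb{R}^2}\left(|\mathcal{F}\{f\}(\mathbf{y})|_Q\,e^{\beta|\mathbf{y}|^2}\right)^q d\mathbf{y}<\infty$; where, if $p=\infty$ (respectively $q=\infty$), condition (i) (respectively (ii)) means that the function $|f(\mathbf{x})|_Q\,e^{\alpha|\mathbf{x}|^2}$ (respectively $|\mathcal{F}\{f\}(\mathbf{y})|_Q\,e^{\beta|\mathbf{y}|^2}$) is essentially bounded on $\mathbb{R}^2$. Then: 1. If $\alpha\beta>\pi^2$, every such $f$ satisfying (i) and (ii) is $0$ almost everywhere. 2. If $\alpha\beta=\pi^2$, every such $f$ satisfying (i) and (ii) is (almost everywhere) a constant quaternion multiple of $e^{-\alpha|\mathbf{x}|^2}$. 3. If $\alpha\beta<\pi^2$, there are infinitely many linearly independent functions satisfying both (i) and (ii).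
   Context: $\mathbb{H}$ denotes the algebra of real quaternions $q=q_0+\mathbf{i}q_1+\mathbf{j}q_2+\mathbf{k}q_3$ ($q_m\in\mathbb{R}$), with $\mathbf{i}^2=\mathbf{j}^2=\mathbf{k}^2=-1$, $\mathbf{i}\mathbf{j}=-\mathbf{j}\mathbf{i}=\mathbf{k}$, $\mathbf{j}\mathbf{k}=-\mathbf{k}\mathbf{j}=\mathbf{i}$, $\mathbf{k}\mathbf{i}=-\mathbf{i}\mathbf{k}=\mathbf{j}$, and modulus $|q|_Q=\sqrt{q_0^2+q_1^2+q_2^2+q_3^2}$. For $\mathbf{x}=(x_1,x_2)\in\mathbb{R}^2$, $|\mathbf{x}|=\sqrt{x_1^2+x_2^2}$, and $d\mathbf{x}$ is Lebesgue measure on $\mathbb{R}^2$. For $1\le r<\infty$, $L^r(\mathbb{R}^2,\mathbb{H})$ is the space of measurable $f:\mathbb{R}^2\to\mathbb{H}$ with $\int_{\mathbb{R}^2}|f(\mathbf{x})|_Q^r\,d\mathbf{x}<\infty$. The two-sided quaternion Fourier transform of $f\in L^1(\mathbb{R}^2,\mathbb{H})$ is $$\mathcal{F}\{f\}(\boldsymbol{\xi})=\int_{\mathbb{R}^2}e^{-\mathbf{i}2\pi\xi_1x_1}\,f(\mathbf{x})\,e^{-\mathbf{j}2\pi\xi_2x_2}\,d\mathbf{x},\qquad \boldsymbol{\xi}=(\xi_1,\xi_2)\in\mathbb{R}^2 .$$ *)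

theory Defs
  imports "HOL-Analysis.Analysis"
begin

datatype quat = Quat (Q0: real) (Q1: real) (Q2: real) (Q3: real)

lemma quat_eq_iff: "p = q \<longleftrightarrow> Q0 p = Q0 q \<and> Q1 p = Q1 q \<and> Q2 p = Q2 q \<and> Q3 p = Q3 q"
  by (auto intro: quat.expand)

instantiation quat :: real_vector
begin

definition "0 = Quat 0 0 0 0"
definition "p + q = Quat (Q0 p + Q0 q) (Q1 p + Q1 q) (Q2 p + Q2 q) (Q3 p + Q3 q)"
definition "- q = Quat (- Q0 q) (- Q1 q) (- Q2 q) (- Q3 q)"
definition "p - q = Quat (Q0 p - Q0 q) (Q1 p - Q1 q) (Q2 p - Q2 q) (Q3 p - Q3 q)"
definition "r *\<^sub>R q = Quat (r * Q0 q) (r * Q1 q) (r * Q2 q) (r * Q3 q)"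

instance
  by standard
    (simp_all add: quat_eq_iff zero_quat_def plus_quat_def uminus_quat_def minus_quat_def
      scaleR_quat_def algebra_simps)

end

lemma quat_vector_simps [simp]:
  "Q0 0 = 0" "Q1 0 = 0" "Q2 0 = 0" "Q3 0 = 0"
  "Q0 (p + q) = Q0 p + Q0 q" "Q1 (p + q) = Q1 p + Q1 q"
  "Q2 (p + q) = Q2 p + Q2 q" "Q3 (p + q) = Q3 p + Q3 q"
  "Q0 (- q) = - Q0 q" "Q1 (- q) = - Q1 q" "Q2 (- q) = - Q2 q" "Q3 (- q) = - Q3 q"
  "Q0 (p - q) = Q0 p - Q0 q" "Q1 (p - q) = Q1 p - Q1 q"
  "Q2 (p - q) = Q2 p - Q2 q" "Q3 (p - q) = Q3 p - Q3 q"
  "Q0 (r *\<^sub>R q) = r * Q0 q" "Q1 (r *\<^sub>R q) = r * Q1 q"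
  "Q2 (r *\<^sub>R q) = r * Q2 q" "Q3 (r *\<^sub>R q) = r * Q3 q"
  by (simp_all add: zero_quat_def plus_quat_def uminus_quat_def minus_quat_def scaleR_quat_def)

instantiation quat :: real_algebra_1
begin

definition "1 = Quat 1 0 0 0"

definition "p * q = Quat
  (Q0 p * Q0 q - Q1 p * Q1 q - Q2 p * Q2 q - Q3 p * Q3 q)
  (Q0 p * Q1 q + Q1 p * Q0 q + Q2 p * Q3 q - Q3 p * Q2 q)
  (Q0 p * Q2 q - Q1 p * Q3 q + Q2 p * Q0 q + Q3 p * Q1 q)
  (Q0 p * Q3 q + Q1 p * Q2 q - Q2 p * Q1 q + Q3 p * Q0 q)"

instance
  by standard (simp_all add: quat_eq_iff one_quat_def times_quat_def algebra_simps)

end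

lemma quat_algebra_simps [simp]:
  "Q0 1 = 1" "Q1 1 = 0" "Q2 1 = 0" "Q3 1 = 0"
  "Q0 (p * q) = Q0 p * Q0 q - Q1 p * Q1 q - Q2 p * Q2 q - Q3 p * Q3 q"
  "Q1 (p * q) = Q0 p * Q1 q + Q1 p * Q0 q + Q2 p * Q3 q - Q3 p * Q2 q"
  "Q2 (p * q) = Q0 p * Q2 q - Q1 p * Q3 q + Q2 p * Q0 q + Q3 p * Q1 q"
  "Q3 (p * q) = Q0 p * Q3 q + Q1 p * Q2 q - Q2 p * Q1 q + Q3 p * Q0 q"
  by (simp_all add: one_quat_def times_quat_def)

instantiation quat :: real_inner
begin

definition "inner p q = Q0 p * Q0 q + Q1 p * Q1 q + Q2 p * Q2 q + Q3 p * Q3 q"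
definition "norm q = sqrt ((Q0 q)\<^sup>2 + (Q1 q)\<^sup>2 + (Q2 q)\<^sup>2 + (Q3 q)\<^sup>2)"
definition "sgn (q::quat) = q /\<^sub>R norm q"
definition "dist (p::quat) q = norm (p - q)"
definition [code del]:
  "(uniformity :: (quat \<times> quat) filter) = (INF e\<in>{0<..}. principal {(p, q). dist p q < e})"
definition [code del]:
  "open (U :: quat set) \<longleftrightarrow>
    (\<forall>p\<in>U. eventually (\<lambda>(p', q). p' = p \<longrightarrow> q \<in> U) uniformity)"

instance
proof
  fix p q s :: quat and r :: real
  show "0 \<le> inner p p" by (simp add: inner_quat_def)
  show "inner p p = 0 \<longleftrightarrow> p = 0"
  proof
    assume "inner p p = 0"
    then have "(Q0 p)\<^sup>2 + (Q1 p)\<^sup>2 + (Q2 p)\<^sup>2 + (Q3 p)\<^sup>2 = 0"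
      by (simp add: inner_quat_def power2_eq_square)
    then show "p = 0" by (simp add: add_nonneg_eq_0_iff quat_eq_iff)
  qed (simp add: inner_quat_def)
qed (simp_all add: inner_quat_def norm_quat_def sgn_quat_def dist_quat_def
      uniformity_quat_def open_quat_def algebra_simps power2_eq_square)

end

instantiation quat :: real_normed_div_algebra
begin

definition "inverse (q::quat) = Quat (Q0 q) (- Q1 q) (- Q2 q) (- Q3 q) /\<^sub>R (norm q)\<^sup>2"
definition "p div (q::quat) = p * inverse q"

instance
proof
  fix p q :: quat
  show "inverse (0::quat) = 0" by (simp add: quat_eq_iff inverse_quat_def)
  show "p div q = p * inverse q" by (simp add: divide_quat_def)
  have euler:
    "(a*e - b*f - c*g - d*h)\<^sup>2 + (a*f + b*e + c*h - d*g)\<^sup>2 + (a*g - b*h + c*e + d*f)\<^sup>2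
      + (a*h + b*g - c*f + d*e)\<^sup>2 = (a\<^sup>2 + b\<^sup>2 + c\<^sup>2 + d\<^sup>2) * (e\<^sup>2 + f\<^sup>2 + g\<^sup>2 + h\<^sup>2)"
    for a b c d e f g h :: real
    by algebra
  show "norm (p * q) = norm p * norm q"
    by (simp only: norm_quat_def quat_algebra_simps euler real_sqrt_mult)
  define p' where "p' = Quat (Q0 p) (- Q1 p) (- Q2 p) (- Q3 p)"
  have "(norm p)\<^sup>2 = Q0 p * Q0 p + Q1 p * Q1 p + Q2 p * Q2 p + Q3 p * Q3 p"
    by (simp only: power2_norm_eq_inner inner_quat_def)
  then have "p' * p = (norm p)\<^sup>2 *\<^sub>R 1" "p * p' = (norm p)\<^sup>2 *\<^sub>R 1"
    by (simp_all add: quat_eq_iff p'_def)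
  moreover have "inverse p = p' /\<^sub>R (norm p)\<^sup>2"
    by (simp only: inverse_quat_def p'_def)
  moreover assume "p \<noteq> 0"
  ultimately show "inverse p * p = 1" "p * inverse p = 1"
    by simp_all
qed

end

instantiation quat :: euclidean_space
begin

definition "Basis = {Quat 1 0 0 0, Quat 0 1 0 0, Quat 0 0 1 0, Quat 0 0 0 1}"

instance
proof
  show "finite (Basis :: quat set)" "(Basis :: quat set) \<noteq> {}"
    by (simp_all only: Basis_quat_def finite.intros) simp
  show "inner u v = (if u = v then 1 else 0)" if "u \<in> Basis" "v \<in> Basis" for u v :: quat
    using that unfolding Basis_quat_def
    by (elim insertE emptyE) (simp_all add: inner_quat_def)
  show "(\<forall>u\<in>Basis. inner p u = 0) \<longleftrightarrow> p = 0" for p :: quat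
    by (simp only: Basis_quat_def ball_simps inner_quat_def quat.sel quat_eq_iff quat_vector_simps) simp
qed

end

definition qi :: quat where "qi = Quat 0 1 0 0"
definition qj :: quat where "qj = Quat 0 0 1 0"
definition qk :: quat where "qk = Quat 0 0 0 1"

lemma quat_units:
  "qi * qi = -1" "qj * qj = -1" "qk * qk = -1"
  "qi * qj = qk" "qj * qi = - qk" "qj * qk = qi" "qk * qj = - qi"
  "qk * qi = qj" "qi * qk = - qj"
  "Quat a b c d = of_real a + qi * of_real b + qj * of_real c + qk * of_real d"
  by (simp_all add: quat_eq_iff qi_def qj_def qk_def of_real_def)

text \<open>
  The plane is \<open>real \<times> real\<close>, whose norm is the Euclidean one and whose \<open>lebesgue\<close> measure is
  the completed two-dimensional one. Functions are not identified up to null sets; the statements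
  below are about almost everywhere equality instead.
\<close>

definition Lr_quat :: "real \<Rightarrow> (real \<times> real \<Rightarrow> quat) set" where
  "Lr_quat r = {f \<in> borel_measurable lebesgue.
     (\<integral>\<^sup>+x. ennreal (norm (f x) powr r) \<partial>lebesgue) < \<infinity>}"

definition qft :: "(real \<times> real \<Rightarrow> quat) \<Rightarrow> real \<times> real \<Rightarrow> quat" where
  "qft f \<xi> = (LINT x|lebesgue.
     exp (- ((2 * pi * fst \<xi> * fst x) *\<^sub>R qi)) * f x * exp (- ((2 * pi * snd \<xi> * snd x) *\<^sub>R qj)))"

definition gauss_weighted_Lp :: "real \<Rightarrow> ennreal \<Rightarrow> (real \<times> real \<Rightarrow> quat) \<Rightarrow> bool" where
  "gauss_weighted_Lp c p g \<longleftrightarrow>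
     (if p = \<infinity> then \<exists>C. AE x in lebesgue. norm (g x) * exp (c * (norm x)\<^sup>2) \<le> C
      else (\<integral>\<^sup>+x. ennreal ((norm (g x) * exp (c * (norm x)\<^sup>2)) powr enn2real p) \<partial>lebesgue) < \<infinity>)"

text \<open>
  Linear independence over the quaternions of a set of functions modulo null functions, for
  coefficients acting on the left, respectively on the right. Each of these implies linear
  independence over the reals.
\<close>

definition left_lin_indep_ae :: "(real \<times> real \<Rightarrow> quat) set \<Rightarrow> bool" where
  "left_lin_indep_ae S \<longleftrightarrow>
     (\<forall>T a. finite T \<longrightarrow> T \<subseteq> S \<longrightarrow> (AE x in lebesgue. (\<Sum>g\<in>T. a g * g x) = 0) \<longrightarrow>
       (\<forall>g\<in>T. a g = 0))"

definition right_lin_indep_ae :: "(real \<times> real \<Rightarrow> quat) set \<Rightarrow> bool" where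
  "right_lin_indep_ae S \<longleftrightarrow>
     (\<forall>T a. finite T \<longrightarrow> T \<subseteq> S \<longrightarrow> (AE x in lebesgue. (\<Sum>g\<in>T. g x * a g) = 0) \<longrightarrow>
       (\<forall>g\<in>T. a g = 0))"

end

theory Submission
  imports Defs "HOL-Probability.Levy" "HOL-Complex_Analysis.Conformal_Mappings"
begin

text \<open>
  Writing \<open>f = u (1 + k) + v (1 - k)\<close> with complex-valued \<open>u\<close> and \<open>v\<close> turns the two-sided
  quaternion transform into the ordinary Fourier transforms of \<open>u\<close> (reflected in the second
  frequency) and \<open>v\<close>. It remains to treat a complex-valued \<open>u\<close> in the critical case
  \<open>\<beta> = \<pi>\<^sup>2 / \<alpha>\<close>. Both weighted conditions bound the weighted function by a constant plus an
  integrable function. On a line in frequency space, the decay of \<open>u\<close> extends its transform \<open>F\<close>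
  to an entire function \<open>E\<close> with \<open>|E z| \<le> M exp (\<beta> (Im z)\<^sup>2)\<close>, so \<open>g z = exp (\<beta> z\<^sup>2) E z\<close> satisfies
  \<open>|g z| \<le> M exp (\<beta> (Re z)\<^sup>2)\<close>, and on almost every line parallel to an axis \<open>g\<close> is bounded on the
  reals by a constant plus an integrable function. Phragmen--Lindelof and Liouville make \<open>g\<close>
  constant. Hence \<open>F\<close> is a multiple of a Gaussian, and by injectivity of the transform so is \<open>u\<close>.

  If \<open>\<alpha> \<beta> > \<pi>\<^sup>2\<close>, the critical case applies both to \<open>\<alpha>\<close> and to \<open>\<pi>\<^sup>2 / \<beta> < \<alpha>\<close>, and multiples of
  Gaussians of different widths agree only if they vanish. If \<open>\<alpha> \<beta> < \<pi>\<^sup>2\<close>, the Gaussians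
  \<open>exp (- c |x|\<^sup>2)\<close> with \<open>\<alpha> < c < \<pi>\<^sup>2 / \<beta>\<close> satisfy both conditions.
\<close>

subsection \<open>Entire functions of order two\<close>

text \<open>
  Phragmen--Lindelof in a sector of opening \<open>t < \<pi> / 2\<close>, parametrised by a strip through \<open>exp\<close>.
  The factor \<open>exp (i \<gamma> z\<^sup>2)\<close> has modulus 1 on the real axis, and its \<open>\<gamma>\<close> is chosen to cancel the
  growth of \<open>G\<close> on the other ray.
\<close>

lemma entire_sector_bound:
  fixes G :: "complex \<Rightarrow> complex" and A K t :: real
  assumes hol: "G holomorphic_on UNIV"
    and growth: "\<And>z. cmod (G z) \<le> A * exp (K * (Re z)\<^sup>2)"
    and real: "\<And>x. cmod (G (of_real x)) \<le> A"
    and K: "K > 0" and t: "0 < t" "t < pi / 2"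
    and w: "0 \<le> Im w" "Im w \<le> t"
  shows "cmod (G (exp w)) \<le> A * exp (K / 2 * cot t * exp (2 * Re w) * sin (2 * Im w))"
proof -
  have A: "A \<ge> 0" using order_trans[OF norm_ge_zero real[of 0]] .
  define \<gamma> where "\<gamma> = K / 2 * cot t"
  have \<gamma>: "\<gamma> > 0" unfolding \<gamma>_def using K t by (intro mult_pos_pos cot_gt_zero) auto
  \<comment> \<open>The rate \<open>a\<close> lies strictly between 2 and \<open>pi / t\<close>:
    above 2 so that \<open>exp (a * R)\<close> outgrows \<open>exp (2 * R)\<close>, below
    \<open>pi / t\<close> so that the cosine stays at least \<open>\<delta> > 0\<close> on the whole
    strip.\<close>
  define a where "a = (2 + pi / t) / 2"
  have pt: "pi / t > 2" using t by (simp add: field_simps)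
  have a2: "a > 2" using pt by (simp add: a_def)
  have "(2 + r) / 2 < r" if "2 < r" for r :: real using that by simp
  from this[OF pt] have "a < pi / t" by (simp only: a_def)
  then have at: "a * t < pi" using t by (simp add: field_simps)
  define \<delta> where "\<delta> = cos (a * t / 2)"
  have \<delta>: "\<delta> > 0" unfolding \<delta>_def using at a2 t by (intro cos_gt_zero_pi) (auto intro: less_le_trans[of _ 0])
  have cos_ge: "cos (a * (y - t / 2)) \<ge> \<delta>" if "0 \<le> y" "y \<le> t" for y
  proof -
    have "\<bar>a * (y - t / 2)\<bar> \<le> a * t / 2"
    proof -
      have "\<bar>y - t / 2\<bar> \<le> t / 2" using that by arith
      then have "a * \<bar>y - t / 2\<bar> \<le> a * (t / 2)" using a2 by (intro mult_left_mono) auto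
      then show ?thesis using a2 by (simp add: abs_mult)
    qed
    then have "cos (a * t / 2) \<le> cos \<bar>a * (y - t / 2)\<bar>"
      using at a2 t by (intro cos_monotone_0_pi_le) auto
    then show ?thesis by (simp add: \<delta>_def)
  qed
  \<comment> \<open>The \<epsilon>-factor is
    \<open>exp (- 2 \<epsilon> cosh (a (z - i t / 2)))\<close>, centred on the middle line of the
    strip; it absorbs the growth of \<open>G\<close> on the far vertical sides of a large
    rectangle.\<close>
  define \<Phi> where "\<Phi> = (\<lambda>\<epsilon> z. G (exp z) * exp (\<i> * of_real \<gamma> * exp (2 * z)) *
      exp (- of_real \<epsilon> * (exp (of_real a * (z - \<i> * of_real (t / 2))) + exp (- of_real a * (z - \<i> * of_real (t / 2))))))"
  have normPhi: "cmod (\<Phi> \<epsilon> z) = cmod (G (exp z)) * exp (- \<gamma> * exp (2 * Re z) * sin (2 * Im z)) *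
     exp (- \<epsilon> * ((exp (a * Re z) + exp (- a * Re z)) * cos (a * (Im z - t / 2))))" for \<epsilon> z
    unfolding \<Phi>_def norm_mult norm_exp_eq_Re
    by (simp add: Re_exp Im_exp algebra_simps cos_diff sin_diff)
  have bound: "cmod (\<Phi> \<epsilon> w) \<le> A" if \<epsilon>: "\<epsilon> > 0" for \<epsilon>
  proof -
    \<comment> \<open>The last term solves
      \<open>K * exp (2 * R) = \<epsilon> * \<delta> * exp (a * R)\<close> for \<open>R\<close>; the
      term \<open>\<bar>Re w\<bar>\<close> puts \<open>w\<close> inside the rectangle.\<close>
    define R where "R = max (max 1 \<bar>Re w\<bar>) (ln (K / (\<epsilon> * \<delta>)) / (a - 2))"
    have R: "R \<ge> 1" "R \<ge> \<bar>Re w\<bar>" "R \<ge> ln (K / (\<epsilon> * \<delta>)) / (a - 2)" by (auto simp: R_def)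
    have "ln (K / (\<epsilon> * \<delta>)) \<le> (a - 2) * R" using R(3) a2 by (simp add: field_simps)
    then have "K / (\<epsilon> * \<delta>) \<le> exp ((a - 2) * R)"
      using K \<epsilon> \<delta> by (metis exp_ln exp_le_cancel_iff divide_pos_pos mult_pos_pos)
    then have "K * exp (2 * R) \<le> \<epsilon> * \<delta> * exp ((a - 2) * R) * exp (2 * R)"
      using \<epsilon> \<delta> by (simp add: field_simps)
    also have "\<dots> = \<epsilon> * \<delta> * exp (a * R)"
      by (simp add: mult.assoc flip: exp_add) (simp add: algebra_simps)
    finally have KR: "K * exp (2 * R) \<le> \<epsilon> * \<delta> * exp (a * R)" .
    let ?S = "cbox (Complex (-R) 0) (Complex R t)"
    have le: "cmod (\<Phi> \<epsilon> z) \<le> A" if z: "z \<in> frontier ?S" for z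
    proof -
      have zc: "-R \<le> Re z" "Re z \<le> R" "0 \<le> Im z" "Im z \<le> t"
        and zf: "Re z = -R \<or> Re z = R \<or> Im z = 0 \<or> Im z = t"
        using z by (auto simp: frontier_cbox in_box_complex_iff in_cbox_complex_iff)
      have s0: "sin (2 * Im z) \<ge> 0" using zc t by (intro sin_ge_zero) auto
      have E: "exp (- \<epsilon> * ((exp (a * Re z) + exp (- a * Re z)) * cos (a * (Im z - t / 2)))) \<le> 1"
        using cos_ge[OF zc(3,4)] \<delta> \<epsilon> by (simp add: zero_le_mult_iff add_nonneg_nonneg)
      have M: "exp (- \<gamma> * exp (2 * Re z) * sin (2 * Im z)) \<le> 1" using s0 \<gamma> by (simp add: zero_le_mult_iff)
      have G: "cmod (G (exp z)) \<le> A * exp (K * exp (2 * Re z) * (cos (Im z))\<^sup>2)"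
        using growth[of "exp z"] by (simp add: Re_exp power_mult_distrib mult.assoc exp_double)
      consider "Im z = 0" | "Im z = t" | "Re z = -R \<or> Re z = R" using zf by blast
      then show ?thesis
      proof cases
        case 1
        then have "exp z = of_real (exp (Re z))" by (simp add: complex_eq_iff Re_exp Im_exp)
        then have "cmod (G (exp z)) \<le> A" using real by metis
        then have "cmod (\<Phi> \<epsilon> z) \<le> A * 1 * 1" unfolding normPhi using E M A
          by (intro mult_mono) auto
        then show ?thesis by simp
      next
        case 2
        have "cmod (\<Phi> \<epsilon> z) \<le> A * exp (K * exp (2 * Re z) * (cos (Im z))\<^sup>2)
            * exp (- \<gamma> * exp (2 * Re z) * sin (2 * Im z)) * 1" unfolding normPhi using E G A
          by (intro mult_mono) auto
        also have "\<dots> = A * exp (K * exp (2 * Re z) * (cos t)\<^sup>2 - \<gamma> * exp (2 * Re z) * sin (2 * t))"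
          using 2 by (simp add: exp_diff exp_minus field_simps)
        also have "K * exp (2 * Re z) * (cos t)\<^sup>2 - \<gamma> * exp (2 * Re z) * sin (2 * t) = 0"
          using t sin_gt_zero[of t] by (simp add: \<gamma>_def cot_def sin_double power2_eq_square)
        finally show ?thesis by simp
      next
        case 3
        have "exp (a * Re z) + exp (- a * Re z) \<ge> exp (a * R)" using 3 by auto
        then have "(exp (a * Re z) + exp (- a * Re z)) * cos (a * (Im z - t / 2)) \<ge> exp (a * R) * \<delta>"
          using cos_ge[OF zc(3,4)] \<delta> by (intro mult_mono) auto
        then have E': "exp (- \<epsilon> * ((exp (a * Re z) + exp (- a * Re z)) * cos (a * (Im z - t / 2))))
            \<le> exp (- \<epsilon> * (exp (a * R) * \<delta>))" using \<epsilon> by simp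
        have "K * exp (2 * Re z) * (cos (Im z))\<^sup>2 \<le> K * exp (2 * R) * 1"
          using zc K by (intro mult_mono) (auto simp: abs_square_le_1)
        then have G': "cmod (G (exp z)) \<le> A * exp (K * exp (2 * R))"
          using G A by (smt (verit) exp_le_cancel_iff mult_left_mono)
        have "cmod (\<Phi> \<epsilon> z) \<le> A * exp (K * exp (2 * R)) * 1 * exp (- \<epsilon> * (exp (a * R) * \<delta>))"
          unfolding normPhi using E' G' M A by (intro mult_mono) auto
        also have "\<dots> = A * exp (K * exp (2 * R) - \<epsilon> * \<delta> * exp (a * R))"
          by (simp add: exp_diff exp_minus field_simps)
        also have "\<dots> \<le> A * 1" using KR A by (intro mult_left_mono) auto
        finally show ?thesis by simp
      qed
    qed
    have holG: "(\<lambda>z. G (exp z)) holomorphic_on T" for T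
      using holomorphic_on_compose_gen[OF _ hol, of exp T] by (auto simp: o_def intro: holomorphic_intros)
    have holP: "\<Phi> \<epsilon> holomorphic_on T" for T
      unfolding \<Phi>_def by (intro holomorphic_intros holG)
    show ?thesis
    proof (rule maximum_modulus_frontier[of "\<Phi> \<epsilon>" ?S])
      show "w \<in> ?S" using w R by (auto simp: in_cbox_complex_iff)
    qed (auto intro!: holP holomorphic_on_imp_continuous_on le bounded_cbox)
  qed
  \<comment> \<open>The bound on \<open>\<Phi>\<close> at \<open>w\<close> is uniform in \<epsilon>,
    so letting \<epsilon> tend to 0 removes the auxiliary factor.\<close>
  let ?c = "(exp (a * Re w) + exp (- a * Re w)) * cos (a * (Im w - t / 2))"
  let ?g = "cmod (G (exp w)) * exp (- \<gamma> * exp (2 * Re w) * sin (2 * Im w))"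
  have "((\<lambda>\<epsilon>. ?g * exp (- \<epsilon> * ?c)) \<longlongrightarrow> ?g * exp (- 0 * ?c)) (at_right 0)"
    by (intro tendsto_intros)
  moreover have "eventually (\<lambda>\<epsilon>. ?g * exp (- \<epsilon> * ?c) \<le> A) (at_right 0)"
    using bound by (auto simp: eventually_at_filter normPhi)
  ultimately have "?g * exp (- 0 * ?c) \<le> A"
    by (intro tendsto_upperbound) auto
  then show ?thesis
    by (simp add: \<gamma>_def exp_minus field_simps)
qed

text \<open>As the opening \<open>t\<close> grows to \<open>pi / 2\<close>, \<open>cot t\<close>
  tends to 0 and the exponent in \<open>entire_sector_bound\<close> vanishes at the fixed point
  \<open>w = Ln z\<close>.\<close>

lemma entire_quadrant_bound:
  fixes G :: "complex \<Rightarrow> complex" and A K :: real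
  assumes hol: "G holomorphic_on UNIV"
    and growth: "\<And>z. cmod (G z) \<le> A * exp (K * (Re z)\<^sup>2)"
    and real: "\<And>x. cmod (G (of_real x)) \<le> A"
    and K: "K > 0" and z: "0 < Re z" "0 < Im z"
  shows "cmod (G z) \<le> A"
proof -
  have z0: "z \<noteq> 0" using z by auto
  define w where "w = Ln z"
  have w: "exp w = z" "0 < Im w" "Im w < pi / 2"
    using z z0 Re_Ln_pos_lt_imp[of z] Im_Ln_pos_lt_imp[of z] by (auto simp: w_def)
  let ?f = "\<lambda>t. A * exp (K / 2 * cot t * exp (2 * Re w) * sin (2 * Im w))"
  have "isCont ?f (pi / 2)" by (intro continuous_intros) auto
  then have "(?f \<longlongrightarrow> ?f (pi / 2)) (at_left (pi / 2))"
    by (simp add: isCont_def filterlim_at_split)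
  moreover have "eventually (\<lambda>t. cmod (G z) \<le> ?f t) (at_left (pi / 2))"
    using eventually_at_left_real[OF w(3)]
  proof eventually_elim
    case (elim t)
    then show ?case using entire_sector_bound[OF hol growth real K, of t w] w by auto
  qed
  ultimately have "cmod (G z) \<le> ?f (pi / 2)"
    by (intro tendsto_lowerbound) auto
  then show ?thesis by (simp add: cot_def)
qed

text \<open>Composing with \<open>z \<mapsto> - z\<close> and conjugating both argument and value
  preserve the hypotheses, so the quadrant bound holds in all four open quadrants. On the imaginary
  axis the growth bound itself reads \<open>A\<close>. Liouville then applies.\<close>

lemma entire_constant_if_bounded_on_reals:
  fixes G :: "complex \<Rightarrow> complex" and A K :: real
  assumes hol: "G holomorphic_on UNIV"
    and growth: "\<And>z. cmod (G z) \<le> A * exp (K * (Re z)\<^sup>2)"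
    and real: "\<And>x. cmod (G (of_real x)) \<le> A"
    and K: "K > 0"
  shows "G constant_on UNIV"
proof (rule Liouville_theorem[OF hol])
  have neg: "(\<lambda>z. F (- z)) holomorphic_on UNIV" if "F holomorphic_on UNIV" for F :: "complex \<Rightarrow> complex"
    using holomorphic_on_compose_gen[OF holomorphic_on_minus[OF holomorphic_on_ident] that, of UNIV]
    by (simp add: o_def)
  have cnj: "(\<lambda>z. cnj (F (cnj z))) holomorphic_on UNIV" if "F holomorphic_on UNIV" for F :: "complex \<Rightarrow> complex"
    using holomorphic_on_compose_cnj_cnj[of F UNIV] holomorphic_on_subset[OF that] by (auto simp: o_def)
  have 1: "cmod (G z) \<le> A" if "Re z > 0" "Im z > 0" for z
    using entire_quadrant_bound[OF hol growth real K that] .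
  have 2: "cmod (G z) \<le> A" if "Re z < 0" "Im z < 0" for z
    using entire_quadrant_bound[OF neg[OF hol], of A K "-z"] growth[of "- _"] real[of "- _"] K that by auto
  have 3: "cmod (G z) \<le> A" if "Re z > 0" "Im z < 0" for z
    using entire_quadrant_bound[OF cnj[OF hol], of A K "cnj z"] growth[of "cnj _"] real K that by auto
  have 4: "cmod (G z) \<le> A" if "Re z < 0" "Im z > 0" for z
    using entire_quadrant_bound[OF cnj[OF neg[OF hol]], of A K "- cnj z"] growth[of "- cnj _"] real[of "- _"] K that by auto
  have 5: "cmod (G z) \<le> A" if "Re z = 0" for z
    using growth[of z] that by simp
  have 6: "cmod (G z) \<le> A" if "Im z = 0" for z
    using real[of "Re z"] that by (simp add: complex_is_Real_iff of_real_Re)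
  have "cmod (G z) \<le> A" for z
    using 1[of z] 2[of z] 3[of z] 4[of z] 5[of z] 6[of z] by linarith
  then show "bounded (range G)" by (auto simp: bounded_iff)
qed

text \<open>
  The differences \<open>P (z + d) - P z\<close> of a primitive \<open>P\<close> are bounded on the real axis, hence
  constant, which makes \<open>g\<close> periodic with every real period \<open>d\<close>.
\<close>

lemma entire_constant_if_real_growth_integrable:
  fixes g :: "complex \<Rightarrow> complex" and A K C :: real and k :: "real \<Rightarrow> real"
  assumes hol: "g holomorphic_on UNIV"
    and growth: "\<And>z. cmod (g z) \<le> A * exp (K * (Re z)\<^sup>2)"
    and K: "K > 0" and C: "C \<ge> 0" and k: "integrable lborel k"
    and ae: "AE x in lborel. cmod (g (of_real x)) \<le> C + k x"
  shows "g (of_real x) = g 0"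
proof -
  have A: "A \<ge> 0" using order_trans[OF norm_ge_zero growth[of 0]] by simp
  obtain P where P: "\<And>z. (P has_field_derivative g z) (at z)"
    using holomorphic_convex_primitive'[OF convex_UNIV open_UNIV hol] by auto
  have contg: "continuous_on UNIV g" using hol by (rule holomorphic_on_imp_continuous_on)
  have shift: "g (z + of_real d) = g z" if d: "d > 0" for d z
  proof -
    define H where "H = (\<lambda>z. P (z + of_real d) - P z)"
    have derH: "(H has_field_derivative (g (z + of_real d) - g z)) (at z)" for z
      unfolding H_def by (intro DERIV_diff P) (use P[of "z + of_real d"] in \<open>simp add: DERIV_shift\<close>)
    have holH: "H holomorphic_on UNIV"
      using derH by (auto simp: holomorphic_on_def field_differentiable_def)
    define B1 where "B1 = A * exp (2 * K * d\<^sup>2) * d"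
    define B2 where "B2 = C * d + (LINT x|lborel. \<bar>k x\<bar>)"
    have B: "B1 \<ge> 0" "B2 \<ge> 0" using A C d by (auto simp: B1_def B2_def)
    \<comment> \<open>Mean value inequality on the segment from \<open>z\<close> to
      \<open>z + d\<close>. Separating \<open>d\<close> from \<open>Re z\<close> in the square costs
      the factor 2 in the exponent.\<close>
    have H1: "cmod (H z) \<le> B1 * exp (2 * K * (Re z)\<^sup>2)" for z
    proof -
      let ?S = "closed_segment z (z + of_real d)"
      have "cmod (P (z + of_real d) - P z) \<le> (A * exp (2 * K * d\<^sup>2 + 2 * K * (Re z)\<^sup>2)) * cmod (z + of_real d - z)"
      proof (rule field_differentiable_bound[where S = ?S and f' = g])
        fix y assume "y \<in> ?S"
        then obtain u where u: "0 \<le> u" "u \<le> 1" "y = z + of_real (u * d)"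
          by (auto simp: in_segment algebra_simps scaleR_conv_of_real)
        have "(Re y)\<^sup>2 \<le> 2 * d\<^sup>2 + 2 * (Re z)\<^sup>2"
        proof -
          have "(Re z + u * d)\<^sup>2 \<le> 2 * (u * d)\<^sup>2 + 2 * (Re z)\<^sup>2"
            using zero_le_power2[of "Re z - u * d"] by (simp add: power2_sum power2_diff)
          moreover have "(u * d)\<^sup>2 \<le> d\<^sup>2" using u d by (intro power_mono) (auto simp: mult_left_le_one_le)
          ultimately show ?thesis using u by simp
        qed
        then have "K * (Re y)\<^sup>2 \<le> 2 * K * d\<^sup>2 + 2 * K * (Re z)\<^sup>2"
          using K by (auto simp: algebra_simps dest: mult_left_mono[of _ _ K])
        then show "cmod (g y) \<le> A * exp (2 * K * d\<^sup>2 + 2 * K * (Re z)\<^sup>2)"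
          using growth[of y] A by (smt (verit) exp_le_cancel_iff mult_left_mono)
      qed (auto intro: has_field_derivative_at_within P)
      then show ?thesis using d by (simp add: H_def B1_def exp_add algebra_simps)
    qed
    \<comment> \<open>On the real axis \<open>H\<close> is the integral of \<open>g\<close> over
      \<open>[x, x + d]\<close>. Integrating \<open>\<bar>k\<bar>\<close> over the whole line
      instead makes the bound independent of \<open>x\<close>.\<close>
    have H2: "cmod (H (of_real x)) \<le> B2" for x
    proof -
      let ?I = "\<lambda>y. indicator {x..x + d} y *\<^sub>R g (of_real y)"
      have cont: "continuous_on {x..x + d} (\<lambda>y. g (of_real y))"
        by (intro continuous_on_compose2[OF contg] continuous_intros) auto
      have hb: "has_bochner_integral lborel ?I (P (of_real (x + d)) - P (of_real x))"
      proof (rule has_bochner_integral_FTC_Icc)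
        fix y
        show "((\<lambda>y. P (of_real y)) has_vector_derivative g (of_real y)) (at y within {x..x + d})"
          by (rule has_vector_derivative_real_field[OF P])
      qed (use d cont in auto)
      have "cmod (LINT y|lborel. ?I y) \<le> (LINT y|lborel. cmod (?I y))"
        by (rule integral_norm_bound)
      also have "\<dots> \<le> (LINT y|lborel. C * indicator {x..x + d} y + \<bar>k y\<bar>)"
      proof (rule integral_mono_AE)
        show "integrable lborel (\<lambda>y. cmod (?I y))" using hb by (intro integrable_norm) (simp add: has_bochner_integral_iff)
      next
        show "integrable lborel (\<lambda>y. C * indicator {x..x + d} y + \<bar>k y\<bar>)"
          using k by (intro Bochner_Integration.integrable_add integrable_abs integrable_mult_right
            integrable_real_indicator) (auto simp: emeasure_lborel_Icc_eq)
      next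
        show "AE y in lborel. cmod (?I y) \<le> C * indicator {x..x + d} y + \<bar>k y\<bar>"
          using ae by eventually_elim (auto simp: indicator_def)
      qed
      also have "\<dots> = B2" using k d by (subst Bochner_Integration.integral_add) (auto simp: B2_def)
      finally show ?thesis using hb by (simp add: H_def has_bochner_integral_iff)
    qed
    \<comment> \<open>The criterion takes a single constant for both bounds, hence the sum
      \<open>B1 + B2\<close>.\<close>
    have "H constant_on UNIV"
    proof (rule entire_constant_if_bounded_on_reals[OF holH])
      show "cmod (H z) \<le> (B1 + B2) * exp (2 * K * (Re z)\<^sup>2)" for z
        using H1[of z] B by (simp add: distrib_right add_increasing2)
      show "cmod (H (of_real x)) \<le> B1 + B2" for x using H2[of x] B by linarith
    qed (use K in auto)
    then obtain c where "\<And>z. H z = c" by (auto simp: constant_on_def)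
    then have "H = (\<lambda>_. c)" by auto
    with derH[of z] have "g (z + of_real d) - g z = 0"
      by (metis DERIV_const DERIV_unique)
    then show ?thesis by simp
  qed
  \<comment> \<open>For negative \<open>x\<close> the shift starts at \<open>x\<close> and moves
    right by \<open>- x\<close> to reach 0.\<close>
  show ?thesis
    using shift[of x 0] shift[of "- x" "of_real x"] by (cases "x = 0"; cases "x > 0") auto
qed

subsection \<open>Injectivity of the Fourier transform\<close>

definition fourier :: "('a::euclidean_space \<Rightarrow> complex) \<Rightarrow> 'a \<Rightarrow> complex" where
  "fourier u y = (LINT x|lborel. u x * cis (- 2 * pi * (x \<bullet> y)))"

lemma borel_measurable_cis [measurable]: "cis \<in> borel_measurable borel"
  by (intro borel_measurable_continuous_onI continuous_intros)

lemma integrable_mult_cis: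
  fixes u :: "'a::euclidean_space \<Rightarrow> complex"
  assumes "integrable lborel u" and [measurable]: "b \<in> borel_measurable borel"
  shows "integrable lborel (\<lambda>x. u x * cis (b x))"
  using assms(1) by (rule Bochner_Integration.integrable_bound) (use assms in \<open>auto simp: norm_mult\<close>)

lemma continuous_on_fourier:
  fixes u :: "'a::euclidean_space \<Rightarrow> complex"
  assumes u: "integrable lborel u"
  shows "continuous_on UNIV (fourier u)"
proof -
  have "isCont (fourier u) y" for y
    unfolding continuous_at_sequentially o_def
  proof (intro allI impI)
    fix s :: "nat \<Rightarrow> 'a" assume s: "s \<longlonglongrightarrow> y"
    show "(\<lambda>n. fourier u (s n)) \<longlonglongrightarrow> fourier u y"
      unfolding fourier_def
    proof (rule integral_dominated_convergence[where w = "\<lambda>x. cmod (u x)"])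
      show "AE x in lborel. (\<lambda>n. u x * cis (- 2 * pi * (x \<bullet> s n))) \<longlonglongrightarrow> u x * cis (- 2 * pi * (x \<bullet> y))"
        using s by (intro AE_I2 tendsto_intros)
    qed (use u in \<open>auto simp: norm_mult\<close>)
  qed
  then show ?thesis by (simp add: continuous_on_eq_continuous_at)
qed

lemma fourier_add:
  assumes "integrable lborel u" "integrable lborel v"
  shows "fourier (\<lambda>x. u x + v x) y = fourier u y + fourier v y"
  using assms unfolding fourier_def by (simp add: distrib_right integrable_mult_cis)

lemma fourier_mult_left: "fourier (\<lambda>x. c * u x) y = c * fourier u y"
  unfolding fourier_def by (simp add: mult.assoc)

lemma fourier_cnj: "fourier (\<lambda>x. cnj (u x)) y = cnj (fourier u (- y))"
proof -
  have "cnj (u x) * cis (- 2 * pi * (x \<bullet> y)) = cnj (u x * cis (- 2 * pi * (x \<bullet> - y)))" for x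
    by (simp add: cis_cnj)
  then show ?thesis unfolding fourier_def by (simp only: Bochner_Integration.integral_cnj)
qed

text \<open>
  The normalised positive and negative parts of \<open>r\<close> are probability densities with equal
  characteristic functions.
\<close>

lemma fourier_injective_real_valued:
  fixes r :: "real \<Rightarrow> real"
  assumes r: "integrable lborel r" and zero: "\<And>y. fourier (\<lambda>x. of_real (r x)) y = 0"
  shows "AE x in lborel. r x = 0"
proof -
  define p n where "p = (\<lambda>x. max 0 (r x))" and "n = (\<lambda>x. max 0 (- r x))"
  have pn: "r x = p x - n x" "p x \<ge> 0" "n x \<ge> 0" for x by (auto simp: p_def n_def max_def)
  have int: "integrable lborel p" "integrable lborel n" using r by (auto simp: p_def n_def)
  have [measurable]: "p \<in> borel_measurable borel" "n \<in> borel_measurable borel" using int by auto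
  have feq: "fourier (\<lambda>x. of_real (p x)) y = fourier (\<lambda>x. of_real (n x)) y" for y
  proof -
    have "fourier (\<lambda>x. complex_of_real (p x)) y
        = fourier (\<lambda>x. of_real (r x) + of_real (n x)) y"
      by (simp add: pn(1))
    also have "\<dots> = fourier (\<lambda>x. of_real (n x)) y"
      using r int zero by (subst fourier_add) auto
    finally show ?thesis .
  qed
  \<comment> \<open>Equality of the two transforms at frequency 0 gives both parts the same mass
    \<open>m\<close>, so one constant normalises both.\<close>
  define m where "m = (LINT x|lborel. p x)"
  have mn: "(LINT x|lborel. n x) = m"
    using feq[of 0] by (simp add: fourier_def m_def flip: cis_zero)
  have m0: "m \<ge> 0" unfolding m_def by (simp add: pn)
  show ?thesis
  proof (cases "m = 0")
    case True
    have "AE x in lborel. p x = 0" "AE x in lborel. n x = 0"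
      using True mn int pn by (simp_all add: m_def flip: integral_nonneg_eq_0_iff_AE)
    then show ?thesis by eventually_elim (simp add: pn)
  next
    case False
    then have m: "m > 0" using m0 by simp
    define D where "D = (\<lambda>f. density lborel (\<lambda>x. ennreal (f x / m)) :: real measure)"
    \<comment> \<open>The characteristic function uses \<open>exp (i t x)\<close>, the transform
      here \<open>exp (- 2 pi i x y)\<close>; hence the frequency
      \<open>- t / (2 * pi)\<close>.\<close>
    have D: "real_distribution (D f)" "char (D f) t = fourier (\<lambda>x. of_real (f x)) (- t / (2 * pi)) / m"
      if f: "integrable lborel f" "\<And>x. f x \<ge> 0" "(LINT x|lborel. f x) = m" for f t
    proof -
      have [measurable]: "f \<in> borel_measurable borel" using f by auto
      have "emeasure (D f) (space (D f)) = (\<integral>\<^sup>+x. ennreal (f x / m) \<partial>lborel)"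
        by (simp add: D_def emeasure_density)
      also have "\<dots> = ennreal (LINT x|lborel. f x / m)"
        using f m by (intro nn_integral_eq_integral) auto
      also have "\<dots> = 1" using f m by simp
      finally have "prob_space (D f)" by (rule prob_spaceI)
      then show "real_distribution (D f)"
        by (auto simp: real_distribution_def real_distribution_axioms_def D_def)
      have "char (D f) t = (LINT x|lborel. (f x / m) *\<^sub>R iexp (t * x))"
        unfolding char_def D_def using f m by (subst integral_density) auto
      also have "\<dots> = (LINT x|lborel. (of_real (f x) * cis (t * x)) / m)"
        by (simp add: scaleR_conv_of_real cis_conv_exp)
      also have "\<dots> = fourier (\<lambda>x. of_real (f x)) (- t / (2 * pi)) / m"
        unfolding fourier_def by (simp add: mult.commute)
      finally show "char (D f) t = fourier (\<lambda>x. of_real (f x)) (- t / (2 * pi)) / m" .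
    qed
    have "D p = D n"
    proof (rule Levy_uniqueness)
      show "char (D p) = char (D n)"
        using D(2)[OF int(1) pn(2)] D(2)[OF int(2) pn(3) mn] feq by (auto simp: m_def)
    qed (use D(1)[OF int(1) pn(2)] D(1)[OF int(2) pn(3) mn] in \<open>auto simp: m_def\<close>)
    then have "AE x in lborel. ennreal (p x / m) = ennreal (n x / m)"
      unfolding D_def by (subst (asm) sigma_finite_measure.density_unique_iff[OF lborel.sigma_finite_measure_axioms]) auto
    then show ?thesis
    proof eventually_elim
      case (elim x)
      then show "r x = 0" using m by (simp add: pn)
    qed
  qed
qed

text \<open>The real and imaginary parts are linear combinations of \<open>u\<close> and its
  conjugate, and by \<open>fourier_cnj\<close> the transform of the conjugate vanishes too.\<close>

lemma fourier_injective_1d: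
  fixes u :: "real \<Rightarrow> complex"
  assumes u: "integrable lborel u" and zero: "\<And>y. fourier u y = 0"
  shows "AE x in lborel. u x = 0"
proof -
  have cz: "fourier (\<lambda>x. cnj (u x)) y = 0" for y by (simp add: fourier_cnj zero)
  have cu: "integrable lborel (\<lambda>x. cnj (u x))" using u by simp
  have "fourier (\<lambda>x. of_real (Re (u x))) y = 0" for y
  proof -
    have "of_real (Re (u x)) = 1 / 2 * (u x + cnj (u x))" for x by (simp add: complex_eq_iff)
    then show ?thesis using u cu zero cz by (simp only: fourier_mult_left fourier_add) simp
  qed
  moreover have "fourier (\<lambda>x. of_real (Im (u x))) y = 0" for y
  proof -
    have "of_real (Im (u x)) = - \<i> / 2 * (u x + - 1 * cnj (u x))" for x by (simp add: complex_eq_iff)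
    then have "fourier (\<lambda>x. of_real (Im (u x))) y = - \<i> / 2 * fourier (\<lambda>x. u x + - 1 * cnj (u x)) y"
      by (simp only: fourier_mult_left)
    also have "\<dots> = 0" using u cu zero cz by (subst fourier_add) (auto simp: fourier_mult_left fourier_mult_left[of "-1", simplified])
    finally show ?thesis .
  qed
  ultimately have "AE x in lborel. Re (u x) = 0" "AE x in lborel. Im (u x) = 0"
    using u by (auto intro!: fourier_injective_real_valued)
  then show ?thesis by eventually_elim (simp add: complex_eq_iff)
qed

text \<open>By Fubini, for fixed \<open>t\<close> the partial transform in the second variable has
  one-dimensional transform \<open>y \<mapsto> fourier u (y, t)\<close>, which is 0. The
  one-dimensional case thus applies once in each variable.\<close>

lemma fourier_injective_2d:
  fixes u :: "real \<times> real \<Rightarrow> complex"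
  assumes u: "integrable lborel u" and zero: "\<And>y. fourier u y = 0"
  shows "AE x in lborel. u x = 0"
proof -
  have [measurable]: "u \<in> borel_measurable borel" using u by simp
  have meas [measurable]: "u \<in> borel_measurable (borel \<Otimes>\<^sub>M borel)"
    by (simp add: borel_prod)
  have up: "integrable (lborel \<Otimes>\<^sub>M lborel) u" using u by (simp add: lborel_prod)
  have slice: "AE x1 in lborel. fourier (\<lambda>x2. u (x1, x2)) t = 0" for t
  proof (rule fourier_injective_1d)
    have [measurable]: "(\<lambda>x. - 2 * pi * (snd x * t)) \<in> borel_measurable borel"
      by (intro borel_measurable_continuous_onI continuous_intros)
    have i2: "integrable (lborel \<Otimes>\<^sub>M lborel) (\<lambda>x. u x * cis (- 2 * pi * (snd x * t)))"
      unfolding lborel_prod by (intro integrable_mult_cis u) measurable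
    show "integrable lborel (\<lambda>x1. fourier (\<lambda>x2. u (x1, x2)) t)"
      using lborel_pair.integrable_fst'[OF i2] by (simp add: fourier_def)
    fix y :: real
    have [measurable]: "(\<lambda>x. - 2 * pi * (x \<bullet> (y, t))) \<in> borel_measurable borel"
      by (intro borel_measurable_continuous_onI continuous_intros)
    have i3: "integrable (lborel \<Otimes>\<^sub>M lborel) (\<lambda>x. u x * cis (- 2 * pi * (x \<bullet> (y, t))))"
      unfolding lborel_prod by (intro integrable_mult_cis u) measurable
    have cis_split: "cis (- 2 * pi * ((x1, x2) \<bullet> (y, t))) = cis (- 2 * pi * (x2 \<bullet> t)) * cis (- 2 * pi * (x1 \<bullet> y))" for x1 x2
      by (simp add: cis_mult algebra_simps)
    have "fourier (\<lambda>x1. fourier (\<lambda>x2. u (x1, x2)) t) y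
        = (LINT x1|lborel. LINT x2|lborel. u (x1, x2) * cis (- 2 * pi * ((x1, x2) \<bullet> (y, t))))"
      unfolding fourier_def by (simp only: cis_split mult.assoc[symmetric] integral_mult_left_zero)
    also have "\<dots> = fourier u (y, t)"
      using lborel_pair.integral_fst'[OF i3] by (simp add: fourier_def lborel_prod)
    finally show "fourier (\<lambda>x1. fourier (\<lambda>x2. u (x1, x2)) t) y = 0" by (simp add: zero)
  qed
  \<comment> \<open>The null set in \<open>slice\<close> depends on \<open>t\<close>. Countably many
    rational \<open>t\<close> share one null set, and continuity of the slice transform covers the
    remaining \<open>t\<close>.\<close>
  have "AE x1 in lborel. \<forall>t\<in>\<rat>. fourier (\<lambda>x2. u (x1, x2)) t = 0"
    using slice by (intro AE_ball_countable') (auto simp: countable_rat)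
  moreover have "AE x1 in lborel. integrable lborel (\<lambda>x2. u (x1, x2))"
    using lborel_pair.AE_integrable_fst'[OF up] .
  ultimately have "AE x1 in lborel. AE x2 in lborel. u (x1, x2) = 0"
  proof eventually_elim
    case (elim x1)
    show ?case
    proof (rule fourier_injective_1d[OF elim(2)])
      fix y :: real
      have "closed {t. fourier (\<lambda>x2. u (x1, x2)) t = 0}"
        using continuous_on_fourier[OF elim(2)] by (intro closed_Collect_eq) auto
      then have "closure \<rat> \<subseteq> {t. fourier (\<lambda>x2. u (x1, x2)) t = 0}"
        using elim(1) by (intro closure_minimal) auto
      then show "fourier (\<lambda>x2. u (x1, x2)) y = 0" by (auto simp: Rats_closure_real)
    qed
  qed
  moreover have "{x \<in> space (lborel \<Otimes>\<^sub>M lborel). u x = 0} \<in> sets (lborel \<Otimes>\<^sub>M lborel)"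
    unfolding lborel_prod by measurable
  ultimately have "AE x in lborel \<Otimes>\<^sub>M lborel. u x = 0"
    by (intro lborel_pair.AE_pair_measure) auto
  then show ?thesis by (simp only: lborel_prod)
qed

text \<open>The set of disagreement is open and null, hence empty. This upgrades almost-everywhere
  identities between continuous functions to pointwise ones.\<close>

lemma AE_lborel_eq_imp_eq:
  fixes f g :: "'a::euclidean_space \<Rightarrow> 'b::t2_space"
  assumes f: "continuous_on UNIV f" and g: "continuous_on UNIV g" and ae: "AE x in lborel. f x = g x"
  shows "f x = g x"
proof (rule ccontr)
  assume "f x \<noteq> g x"
  let ?S = "{x. f x \<noteq> g x}"
  have op: "open ?S" using f g by (intro open_Collect_neq) auto
  have "?S \<in> null_sets lborel" using ae op by (subst AE_iff_null_sets) auto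
  then have "negligible ?S" by (auto simp: negligible_iff_null_sets intro: null_sets_completionI)
  with open_not_negligible[OF op] \<open>f x \<noteq> g x\<close> show False by blast
qed

subsection \<open>Gaussian decay\<close>

lemma integrable_gauss_1d:
  fixes c :: real
  assumes c: "c > 0"
  shows "integrable lborel (\<lambda>x::real. exp (- c * x\<^sup>2))"
proof -
  have "exp (- c * x\<^sup>2) = sqrt (pi / c) * normal_density 0 (1 / sqrt (2 * c)) x" for x
    using c by (simp add: normal_density_def real_sqrt_divide real_sqrt_mult field_simps)
  then show ?thesis using c by simp
qed

text \<open>Scaling by the standard deviation \<open>s\<close> of the Gaussian turns the integral
  into the characteristic function of the standard normal law.\<close>

lemma fourier_gauss_1d:
  fixes c y :: real
  assumes c: "c > 0"
  shows "fourier (\<lambda>x. of_real (exp (- c * x\<^sup>2))) y = of_real (sqrt (pi / c) * exp (- (pi\<^sup>2 / c) * y\<^sup>2))"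
proof -
  define s where "s = 1 / sqrt (2 * c)"
  have s: "s > 0" "s\<^sup>2 = 1 / (2 * c)" using c by (auto simp: s_def power_divide)
  define t where "t = - 2 * pi * y * s"
  have "fourier (\<lambda>x. of_real (exp (- c * x\<^sup>2))) y
      = \<bar>s\<bar> *\<^sub>R (LINT x|lborel. of_real (exp (- c * (0 + s * x)\<^sup>2)) * cis (- 2 * pi * ((0 + s * x) \<bullet> y)))"
    unfolding fourier_def using s by (intro lborel_integral_real_affine) simp
  also have "\<dots> = s *\<^sub>R (LINT x|lborel. sqrt (2 * pi) * (std_normal_density x *\<^sub>R iexp (t * x)))"
  proof -
    have "of_real (exp (- c * (0 + s * x)\<^sup>2)) * cis (- 2 * pi * ((0 + s * x) \<bullet> y))
        = of_real (sqrt (2 * pi)) * (std_normal_density x *\<^sub>R iexp (t * x))" for x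
      using c s by (simp add: normal_density_def power_mult_distrib t_def cis_conv_exp scaleR_conv_of_real
        algebra_simps flip: of_real_mult)
    then show ?thesis by (simp only: abs_of_pos[OF s(1)])
  qed
  also have "\<dots> = s *\<^sub>R (sqrt (2 * pi) * char std_normal_distribution t)"
    unfolding char_def by (subst integral_density) (auto simp del: mult_scaleR_right)
  also have "\<dots> = of_real (s * sqrt (2 * pi) * exp (- t\<^sup>2 / 2))"
    by (simp add: char_std_normal_distribution scaleR_conv_of_real)
  also have "- t\<^sup>2 / 2 = - (pi\<^sup>2 / c) * y\<^sup>2"
    using c by (simp add: t_def power_mult_distrib s field_simps)
  also have "s * sqrt (2 * pi) = sqrt (pi / c)"
    using c by (simp add: s_def real_sqrt_divide real_sqrt_mult)
  finally show ?thesis .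
qed

lemma norm_prod_sq: "(norm x)\<^sup>2 = (fst x)\<^sup>2 + (snd x)\<^sup>2" for x :: "real \<times> real"
  by (cases x) (simp add: norm_Pair)

lemma integrable_gauss:
  fixes c :: real
  assumes c: "c > 0"
  shows "integrable lborel (\<lambda>x::real \<times> real. exp (- c * (norm x)\<^sup>2))"
proof -
  note g = integrable_gauss_1d[OF c]
  have "integrable (lborel \<Otimes>\<^sub>M lborel) (\<lambda>x::real \<times> real. exp (- c * (norm x)\<^sup>2))"
  proof (rule lborel_pair.Fubini_integrable)
    have "(\<lambda>x::real \<times> real. exp (- c * (norm x)\<^sup>2)) \<in> borel_measurable borel"
      by (intro borel_measurable_continuous_onI continuous_intros)
    then show "(\<lambda>x::real \<times> real. exp (- c * (norm x)\<^sup>2)) \<in> borel_measurable (lborel \<Otimes>\<^sub>M lborel)"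
      by (simp add: lborel_prod)
    have eq: "exp (- c * (norm (x, y))\<^sup>2) = exp (- c * x\<^sup>2) * exp (- c * y\<^sup>2)" for x y :: real
      by (simp add: norm_prod_sq algebra_simps flip: exp_add)
    show "integrable lborel (\<lambda>x::real. LINT y|lborel. norm (exp (- c * (norm (x, y::real))\<^sup>2)))"
      unfolding eq using g by simp
    show "AE x in lborel. integrable lborel (\<lambda>y. exp (- c * (norm (x::real, y::real))\<^sup>2))"
      unfolding eq using g by simp
  qed
  then show ?thesis by (simp add: lborel_prod)
qed

lemma fourier_gauss:
  fixes c :: real and y :: "real \<times> real"
  assumes c: "c > 0"
  shows "fourier (\<lambda>x. of_real (exp (- c * (norm x)\<^sup>2))) y = of_real (pi / c * exp (- (pi\<^sup>2 / c) * (norm y)\<^sup>2))"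
proof -
  let ?g = "\<lambda>x::real. of_real (exp (- c * x\<^sup>2)) :: complex"
  have [measurable]: "(\<lambda>x. - 2 * pi * (x \<bullet> y)) \<in> borel_measurable borel"
    by (intro borel_measurable_continuous_onI continuous_intros)
  have i: "integrable (lborel \<Otimes>\<^sub>M lborel)
      (\<lambda>x::real \<times> real. of_real (exp (- c * (norm x)\<^sup>2)) * cis (- 2 * pi * (x \<bullet> y)))"
    unfolding lborel_prod using integrable_gauss[OF c] by (intro integrable_mult_cis) (auto simp: of_real_def)
  have split: "of_real (exp (- c * (norm (x1, x2))\<^sup>2)) * cis (- 2 * pi * ((x1, x2) \<bullet> y))
      = (?g x1 * cis (- 2 * pi * (x1 \<bullet> fst y))) * (?g x2 * cis (- 2 * pi * (x2 \<bullet> snd y)))" for x1 x2 :: real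
  proof -
    have "exp (- c * (norm (x1, x2))\<^sup>2) = exp (- c * x1\<^sup>2) * exp (- c * x2\<^sup>2)"
      by (simp add: norm_prod_sq algebra_simps flip: exp_add)
    moreover have "cis (- 2 * pi * ((x1, x2) \<bullet> y)) = cis (- 2 * pi * (x1 \<bullet> fst y)) * cis (- 2 * pi * (x2 \<bullet> snd y))"
      by (simp add: inner_prod_def cis_mult algebra_simps)
    ultimately show ?thesis by (simp only: of_real_mult mult_ac)
  qed
  have "fourier (\<lambda>x. of_real (exp (- c * (norm x)\<^sup>2))) y = fourier ?g (fst y) * fourier ?g (snd y)"
    using lborel_pair.integral_fst'[OF i] unfolding split
    by (simp only: fourier_def lborel_prod integral_mult_left_zero integral_mult_right_zero)
  also have "\<dots> = of_real (sqrt (pi / c) * sqrt (pi / c) * exp (- (pi\<^sup>2 / c) * (norm y)\<^sup>2))"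
  proof -
    have "exp (- (pi\<^sup>2 / c) * (norm y)\<^sup>2) = exp (- (pi\<^sup>2 / c) * (fst y)\<^sup>2) * exp (- (pi\<^sup>2 / c) * (snd y)\<^sup>2)"
      by (simp add: norm_prod_sq distrib_left add_divide_distrib flip: exp_add)
    then show ?thesis unfolding fourier_gauss_1d[OF c] by (simp only: of_real_mult mult_ac)
  qed
  also have "sqrt (pi / c) * sqrt (pi / c) = pi / c" using c by simp
  finally show ?thesis .
qed

section \<open>Entire extension of the transform along a line\<close>

context
  fixes u :: "real \<times> real \<Rightarrow> complex" and \<alpha> C :: real and h :: "real \<times> real \<Rightarrow> real" and e :: "real \<times> real"
  assumes u: "integrable lborel u" and \<alpha>: "\<alpha> > 0" and C: "C \<ge> 0" and h: "integrable lborel h"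
    and decay: "AE x in lborel. cmod (u x) * exp (\<alpha> * (norm x)\<^sup>2) \<le> C + h x"
    and e: "norm e = 1"
begin

text \<open>Completing the square gives \<open>2 pi \<eta> (x \<bullet> e) - \<alpha> |x|^2 = pi^2
  \<eta>^2 / \<alpha> - \<alpha> |c + x|^2\<close>, so once the decay of \<open>u\<close> is used
  only a translated Gaussian remains under the integral.\<close>

lemma exponential_moment:
  shows "integrable lborel (\<lambda>x. cmod (u x) * exp (2 * pi * \<eta> * (x \<bullet> e)))" (is "integrable _ ?f")
    and "(LINT x|lborel. cmod (u x) * exp (2 * pi * \<eta> * (x \<bullet> e)))
      \<le> (C * (LINT x|lborel. exp (- \<alpha> * (norm (x :: real \<times> real))\<^sup>2)) + (LINT x|lborel. \<bar>h x\<bar>)) * exp (pi\<^sup>2 / \<alpha> * \<eta>\<^sup>2)"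
proof -
  define c where "c = (- (pi * \<eta> / \<alpha>)) *\<^sub>R e"
  let ?G = "\<lambda>x::real \<times> real. exp (- \<alpha> * (norm x)\<^sup>2)"
  have G: "integrable lborel ?G" by (rule integrable_gauss[OF \<alpha>])
  have Gm: "?G \<in> borel_measurable borel" using G by simp
  have Gc: "integrable lborel (\<lambda>x. ?G (c + x))" "(LINT x|lborel. ?G (c + x)) = (LINT x|lborel. ?G x)"
    using integrable_distr_eq[of "(+) c" lborel borel ?G] integral_distr[of "(+) c" lborel borel ?G] G Gm
    by (simp_all add: lborel_distr_plus)
  have [measurable]: "(\<lambda>x. x \<bullet> e) \<in> borel_measurable borel"
    by (intro borel_measurable_continuous_onI continuous_intros)
  have meas: "?f \<in> borel_measurable lborel" using u by measurable
  have sq: "2 * pi * \<eta> * (x \<bullet> e) = pi\<^sup>2 / \<alpha> * \<eta>\<^sup>2 + (- \<alpha> * (norm (c + x))\<^sup>2) + \<alpha> * (norm x)\<^sup>2" for x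
  proof -
    have "(norm (c + x))\<^sup>2 = c \<bullet> c + 2 * (c \<bullet> x) + (norm x)\<^sup>2"
      by (simp add: power2_norm_eq_inner inner_add inner_commute)
    moreover have "c \<bullet> c = (pi * \<eta> / \<alpha>)\<^sup>2" "c \<bullet> x = - (pi * \<eta> / \<alpha>) * (x \<bullet> e)"
      using e by (simp_all add: c_def norm_eq_1 power2_eq_square inner_commute)
    ultimately show ?thesis using \<alpha> by (simp add: field_simps power2_eq_square)
  qed
  \<comment> \<open>The constant \<open>C\<close> keeps the Gaussian factor in order to be
    integrable; for \<open>\<bar>h x\<bar>\<close> it suffices that this factor is at most
    1.\<close>
  let ?B = "\<lambda>x. (C * ?G (c + x) + \<bar>h x\<bar>) * exp (pi\<^sup>2 / \<alpha> * \<eta>\<^sup>2)"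
  have B: "integrable lborel ?B" using Gc(1) h by simp
  have le: "AE x in lborel. ?f x \<le> ?B x"
    using decay
  proof eventually_elim
    case (elim x)
    have G1: "?G (c + x) \<le> 1" using \<alpha> by simp
    have "?f x = (cmod (u x) * exp (\<alpha> * (norm x)\<^sup>2)) * ?G (c + x) * exp (pi\<^sup>2 / \<alpha> * \<eta>\<^sup>2)"
      unfolding sq exp_add by simp
    also have "\<dots> \<le> (C + \<bar>h x\<bar>) * ?G (c + x) * exp (pi\<^sup>2 / \<alpha> * \<eta>\<^sup>2)"
      using elim by (intro mult_right_mono) auto
    also have "\<dots> \<le> ?B x"
      using mult_left_mono[OF G1, of "\<bar>h x\<bar>"] by (intro mult_right_mono) (auto simp: distrib_right)
    finally show ?case .
  qed
  show int: "integrable lborel ?f"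
    using B meas by (rule Bochner_Integration.integrable_bound) (use le in \<open>eventually_elim, auto\<close>)
  have "(LINT x|lborel. ?f x) \<le> (LINT x|lborel. ?B x)" by (rule integral_mono_AE[OF int B le])
  also have "\<dots> = (C * (LINT x|lborel. ?G x) + (LINT x|lborel. \<bar>h x\<bar>)) * exp (pi\<^sup>2 / \<alpha> * \<eta>\<^sup>2)"
    using Gc h by simp
  finally show "(LINT x|lborel. ?f x) \<le> (C * (LINT x|lborel. ?G x) + (LINT x|lborel. \<bar>h x\<bar>)) * exp (pi\<^sup>2 / \<alpha> * \<eta>\<^sup>2)" .
qed

text \<open>The exponential is expanded in powers of \<open>z\<close> and integrated term by term.
  Exponential moments dominate the partial sums, so the resulting power series converges to the
  integral at every point.\<close>

lemma fourier_line_entire: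
  "(\<lambda>z. LINT x|lborel. u x * cis (- 2 * pi * (x \<bullet> d)) * exp (- 2 * pi * \<i> * (x \<bullet> e) * z)) holomorphic_on UNIV"
    (is "?E holomorphic_on UNIV")
proof -
  have [measurable]: "(\<lambda>x. x \<bullet> e) \<in> borel_measurable borel" "(\<lambda>x. x \<bullet> d) \<in> borel_measurable borel"
    by (intro borel_measurable_continuous_onI continuous_intros)+
  have [measurable]: "u \<in> borel_measurable borel" using u by simp
  define a where "a = (\<lambda>n. LINT x|lborel. u x * cis (- 2 * pi * (x \<bullet> d)) * ((- 2 * pi * \<i> * (x \<bullet> e)) ^ n /\<^sub>R fact n))"
  have sums: "(\<lambda>n. a n * (w - 0) ^ n) sums ?E w" for w
  proof -
    define f where "f = (\<lambda>n x. u x * cis (- 2 * pi * (x \<bullet> d)) * ((- 2 * pi * \<i> * (x \<bullet> e) * w) ^ n /\<^sub>R fact n))"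
    have [measurable]: "f n \<in> borel_measurable borel" for n unfolding f_def by measurable
    define r where "r = (\<lambda>x. 2 * pi * \<bar>x \<bullet> e\<bar> * cmod w)"
    have nf: "cmod (f n x) = cmod (u x) * (r x ^ n /\<^sub>R fact n)" for n x
      by (simp add: f_def norm_mult norm_power r_def power_mult_distrib)
    \<comment> \<open>Since \<open>exp \<bar>s\<bar> \<le> exp s + exp (- s)\<close>, the moments
      with \<eta> equal to \<open>cmod w\<close> and \<open>- cmod w\<close> bound all partial
      sums.\<close>
    let ?B = "\<lambda>x. cmod (u x) * exp (2 * pi * cmod w * (x \<bullet> e)) + cmod (u x) * exp (2 * pi * (- cmod w) * (x \<bullet> e))"
    have B: "integrable lborel ?B" by (intro Bochner_Integration.integrable_add exponential_moment)
    have r0: "r x \<ge> 0" for x by (simp add: r_def)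
    have part: "(\<Sum>i<n. cmod (f i x)) \<le> ?B x" for n x
    proof -
      have "(\<Sum>i<n. r x ^ i /\<^sub>R fact i) \<le> exp (r x)"
        using sum_le_suminf[OF summable_exp_generic[of "r x"], of "{..<n}"] r0[of x] by (simp add: exp_def)
      then have "(\<Sum>i<n. cmod (f i x)) \<le> cmod (u x) * exp (r x)"
        unfolding nf sum_distrib_left[symmetric] by (intro mult_left_mono) auto
      also have "\<dots> \<le> ?B x"
        unfolding distrib_left[symmetric]
        by (intro mult_left_mono) (auto simp: r_def abs_if mult_ac)
      finally show ?thesis .
    qed
    have int: "integrable lborel (f n)" for n
    proof (rule Bochner_Integration.integrable_bound[OF B])
      have "cmod (f n x) \<le> (\<Sum>i<Suc n. cmod (f i x))" for x by (simp add: sum_nonneg)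
      then have "cmod (f n x) \<le> ?B x" for x using part[where n="Suc n" and x=x] order_trans by blast
      then show "AE x in lborel. norm (f n x) \<le> norm (?B x)" by simp
    qed simp
    have sumx: "summable (\<lambda>n. cmod (f n x))" for x
      unfolding nf by (intro summable_mult summable_exp_generic)
    have "(\<lambda>n. LINT x|lborel. f n x) sums (LINT x|lborel. (\<Sum>n. f n x))"
    proof (rule sums_integral)
      show "AE x in lborel. summable (\<lambda>i. norm (f i x))" using sumx by simp
      show "summable (\<lambda>i. LINT x|lborel. norm (f i x))"
      proof (rule bounded_imp_summable)
        fix n
        have "(\<Sum>i\<le>n. LINT x|lborel. norm (f i x)) = (LINT x|lborel. (\<Sum>i<Suc n. norm (f i x)))"
          using int by (subst Bochner_Integration.integral_sum) (auto simp: lessThan_Suc_atMost)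
        also have "\<dots> \<le> (LINT x|lborel. ?B x)"
          using int part[where n="Suc n"] by (intro integral_mono B Bochner_Integration.integrable_sum integrable_norm) auto
        finally show "(\<Sum>i\<le>n. LINT x|lborel. norm (f i x)) \<le> (LINT x|lborel. ?B x)" .
      qed (simp add: integral_nonneg_AE)
    qed (use int in auto)
    moreover have "(LINT x|lborel. f n x) = a n * (w - 0) ^ n" for n
    proof -
      have "f n x = u x * cis (- 2 * pi * (x \<bullet> d)) * ((- 2 * pi * \<i> * (x \<bullet> e)) ^ n /\<^sub>R fact n) * (w - 0) ^ n" for x
        unfolding f_def power_mult_distrib[of _ w] by simp
      then show ?thesis by (simp only: a_def integral_mult_left_zero)
    qed
    moreover have "(\<Sum>n. f n x) = u x * cis (- 2 * pi * (x \<bullet> d)) * exp (- 2 * pi * \<i> * (x \<bullet> e) * w)" for x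
      unfolding f_def exp_def by (intro suminf_mult summable_exp_generic)
    ultimately show ?thesis by simp
  qed
  have "?E holomorphic_on ball 0 r" for r
    by (rule power_series_holomorphic[OF sums])
  then have "?E field_differentiable at z" for z
    using holomorphic_on_imp_differentiable_at[of ?E "ball 0 (norm z + 1)" z] by auto
  then show ?thesis by (auto simp: holomorphic_on_def field_differentiable_at_within)
qed

text \<open>Only the component along \<open>e\<close> is made complex. The offset \<open>d\<close>
  enters through a factor of modulus 1, so the moment bound \<open>M\<close> does not depend on it.
  Multiplying by \<open>exp (\<beta> * z\<^sup>2)\<close> trades growth in \<open>Im z\<close> for
  growth in \<open>Re z\<close>, and on the real axis the modulus becomes the weighted transform,
  bounded by \<open>D + k t\<close>.\<close>

lemma fourier_gauss_on_line:
  assumes D: "D \<ge> 0" and k: "integrable lborel k"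
    and ae: "AE t in lborel. cmod (fourier u (t *\<^sub>R e + d)) * exp (pi\<^sup>2 / \<alpha> * t\<^sup>2) \<le> D + k t"
  shows "fourier u (t *\<^sub>R e + d) = of_real (exp (- (pi\<^sup>2 / \<alpha>) * t\<^sup>2)) * fourier u d"
proof -
  define \<beta> where "\<beta> = pi\<^sup>2 / \<alpha>"
  have \<beta>: "\<beta> > 0" using \<alpha> by (simp add: \<beta>_def)
  define E where "E = (\<lambda>z. LINT x|lborel. u x * cis (- 2 * pi * (x \<bullet> d)) * exp (- 2 * pi * \<i> * (x \<bullet> e) * z))"
  define M where "M = C * (LINT x|lborel. exp (- \<alpha> * (norm (x :: real \<times> real))\<^sup>2)) + (LINT x|lborel. \<bar>h x\<bar>)"
  have E_real: "E (of_real t) = fourier u (t *\<^sub>R e + d)" for t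
  proof -
    have "cis (- 2 * pi * (x \<bullet> d)) * exp (- 2 * pi * \<i> * (x \<bullet> e) * t) = cis (- 2 * pi * (x \<bullet> (t *\<^sub>R e + d)))" for x
      by (simp add: cis_conv_exp algebra_simps flip: exp_add)
    then show ?thesis unfolding E_def fourier_def by (simp only: mult.assoc)
  qed
  have E_le: "cmod (E z) \<le> M * exp (\<beta> * (Im z)\<^sup>2)" for z
  proof -
    have "cmod (E z) \<le> (LINT x|lborel. cmod (u x * cis (- 2 * pi * (x \<bullet> d)) * exp (- 2 * pi * \<i> * (x \<bullet> e) * z)))"
      unfolding E_def by (rule integral_norm_bound)
    also have "\<dots> = (LINT x|lborel. cmod (u x) * exp (2 * pi * Im z * (x \<bullet> e)))"
      by (simp add: norm_mult norm_exp_eq_Re mult_ac)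
    also have "\<dots> \<le> M * exp (\<beta> * (Im z)\<^sup>2)" unfolding M_def \<beta>_def by (rule exponential_moment(2))
    finally show ?thesis .
  qed
  define g where "g = (\<lambda>z. exp (of_real \<beta> * z\<^sup>2) * E z)"
  have "g (of_real t) = g 0" for t
  proof (rule entire_constant_if_real_growth_integrable[OF _ _ \<beta> D k])
    show "g holomorphic_on UNIV"
      unfolding g_def E_def by (intro holomorphic_intros fourier_line_entire)
    show "cmod (g z) \<le> M * exp (\<beta> * (Re z)\<^sup>2)" for z
    proof -
      have "cmod (g z) = exp (\<beta> * (Re z)\<^sup>2 - \<beta> * (Im z)\<^sup>2) * cmod (E z)"
        by (simp add: g_def norm_mult norm_exp_eq_Re power2_eq_square algebra_simps)
      also have "\<dots> \<le> exp (\<beta> * (Re z)\<^sup>2 - \<beta> * (Im z)\<^sup>2) * (M * exp (\<beta> * (Im z)\<^sup>2))"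
        using E_le by (intro mult_left_mono) auto
      also have "\<dots> = M * exp (\<beta> * (Re z)\<^sup>2)" by (simp add: exp_diff)
      finally show ?thesis .
    qed
    show "AE t in lborel. cmod (g (of_real t)) \<le> D + k t"
      using ae
    proof eventually_elim
      case (elim t)
      then show ?case by (simp add: g_def E_real norm_mult norm_exp_eq_Re \<beta>_def mult.commute flip: of_real_power)
    qed
  qed
  from this[of t] have "exp (of_real (\<beta> * t\<^sup>2)) * fourier u (t *\<^sub>R e + d) = fourier u d"
    using E_real[of t] E_real[of 0] by (simp add: g_def mult.commute)
  then show ?thesis by (simp add: exp_minus field_simps flip: \<beta>_def exp_of_real)
qed

end

text \<open>The sign \<open>s\<close> accommodates the reflected second frequency in the transform
  of one quaternion component. Almost every line parallel to an axis carries an integrable bound,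
  and the two resulting factorisations determine the transform from its value at 0.\<close>

theorem hardy_complex:
  fixes u :: "real \<times> real \<Rightarrow> complex" and \<alpha> C D s :: real and h k :: "real \<times> real \<Rightarrow> real"
  assumes u: "integrable lborel u" and \<alpha>: "\<alpha> > 0"
    and C: "C \<ge> 0" and h: "integrable lborel h"
    and decay: "AE x in lborel. cmod (u x) * exp (\<alpha> * (norm x)\<^sup>2) \<le> C + h x"
    and D: "D \<ge> 0" and k: "integrable lborel k" and s: "\<bar>s\<bar> = 1"
    and fdecay: "AE y in lborel. cmod (fourier u (fst y, s * snd y)) * exp (pi\<^sup>2 / \<alpha> * (norm y)\<^sup>2) \<le> D + k y"
  shows "\<exists>c. AE x in lborel. u x = c * of_real (exp (- \<alpha> * (norm x)\<^sup>2))"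
proof -
  define \<beta> where "\<beta> = pi\<^sup>2 / \<alpha>"
  have \<beta>: "\<beta> > 0" using \<alpha> by (simp add: \<beta>_def)
  have ss: "s * s = 1" using s by (metis abs_mult_self_eq mult_1)
  note cont = continuous_on_fourier[OF u]
  have k': "integrable (lborel \<Otimes>\<^sub>M lborel) (\<lambda>(y1, y2). k (y1, y2))" using k by (simp add: lborel_prod)
  \<comment> \<open>On a line parallel to an axis only one coordinate varies; the weight in the
    other coordinate is at least 1 and may be dropped.\<close>
  have slice_bound: "cmod (fourier u (y1, s * y2)) * exp (\<beta> * y1\<^sup>2) \<le> D + k (y1, y2)
      \<and> cmod (fourier u (y1, s * y2)) * exp (\<beta> * y2\<^sup>2) \<le> D + k (y1, y2)"
    if "cmod (fourier u (y1, s * y2)) * exp (\<beta> * (norm (y1, y2))\<^sup>2) \<le> D + k (y1, y2)" for y1 y2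
  proof -
    have "cmod (fourier u (y1, s * y2)) * exp (\<beta> * y1\<^sup>2) \<le> cmod (fourier u (y1, s * y2)) * exp (\<beta> * (norm (y1, y2))\<^sup>2)"
      "cmod (fourier u (y1, s * y2)) * exp (\<beta> * y2\<^sup>2) \<le> cmod (fourier u (y1, s * y2)) * exp (\<beta> * (norm (y1, y2))\<^sup>2)"
      using \<beta> by (auto intro!: mult_left_mono simp: norm_prod_sq)
    with that show ?thesis by linarith
  qed
  have ae1: "AE y1 in lborel. AE y2 in lborel.
      cmod (fourier u (y1, s * y2)) * exp (\<beta> * (norm (y1, y2))\<^sup>2) \<le> D + k (y1, y2)"
  proof -
    have "AE y in lborel \<Otimes>\<^sub>M lborel. cmod (fourier u (fst y, s * snd y)) * exp (\<beta> * (norm y)\<^sup>2) \<le> D + k y"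
      using fdecay by (simp only: lborel_prod \<beta>_def)
    from lborel_pair.AE_pair[OF this] show ?thesis by simp
  qed
  have ae2: "AE y2 in lborel. AE y1 in lborel.
      cmod (fourier u (y1, s * y2)) * exp (\<beta> * (norm (y1, y2))\<^sup>2) \<le> D + k (y1, y2)"
  proof (rule iffD1[OF lborel_pair.AE_commute ae1])
    have [measurable]: "(\<lambda>y. cmod (fourier u (fst y, s * snd y)) * exp (\<beta> * (norm (fst y, snd y))\<^sup>2)) \<in> borel_measurable borel"
      by (intro borel_measurable_continuous_onI continuous_intros continuous_on_compose2[OF cont]) auto
    have [measurable]: "(\<lambda>y. k (fst y, snd y)) \<in> borel_measurable borel" using k by simp
    show "{y \<in> space (lborel \<Otimes>\<^sub>M lborel). cmod (fourier u (fst y, s * snd y)) * exp (\<beta> * (norm (fst y, snd y))\<^sup>2)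
        \<le> D + k (fst y, snd y)} \<in> sets (lborel \<Otimes>\<^sub>M lborel)"
      unfolding lborel_prod by measurable
  qed
  \<comment> \<open>The line result covers almost every \<open>y2\<close>; both sides are continuous
    in \<open>y2\<close>, which gives the rest.\<close>
  have 1: "fourier u (y1, s * y2) = of_real (exp (- \<beta> * y1\<^sup>2)) * fourier u (0, s * y2)" for y1 y2
  proof (rule AE_lborel_eq_imp_eq[where x = y2])
    show "AE y2 in lborel. fourier u (y1, s * y2) = of_real (exp (- \<beta> * y1\<^sup>2)) * fourier u (0, s * y2)"
      using ae2 lborel_pair.AE_integrable_snd[OF k']
    proof eventually_elim
      case (elim y2)
      have "AE t in lborel. cmod (fourier u (t *\<^sub>R (1, 0) + (0, s * y2))) * exp (pi\<^sup>2 / \<alpha> * t\<^sup>2) \<le> D + k (t, y2)"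
        using elim(1) by eventually_elim (use slice_bound in \<open>simp add: \<beta>_def\<close>)
      from fourier_gauss_on_line[OF u \<alpha> C h decay _ D elim(2) this, of y1] show ?case
        by (simp add: \<beta>_def norm_Pair)
    qed
  qed (intro continuous_intros continuous_on_compose2[OF cont]; simp)+
  have 2: "fourier u (y1, s * y2) = of_real (exp (- \<beta> * y2\<^sup>2)) * fourier u (y1, 0)" for y1 y2
  proof (rule AE_lborel_eq_imp_eq[where x = y1])
    show "AE y1 in lborel. fourier u (y1, s * y2) = of_real (exp (- \<beta> * y2\<^sup>2)) * fourier u (y1, 0)"
      using ae1 lborel_pair.AE_integrable_fst[OF k']
    proof eventually_elim
      case (elim y1)
      have "AE t in lborel. cmod (fourier u (t *\<^sub>R (0, s) + (y1, 0))) * exp (pi\<^sup>2 / \<alpha> * t\<^sup>2) \<le> D + k (y1, t)"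
        using elim(1) by eventually_elim (use slice_bound in \<open>simp add: \<beta>_def mult.commute\<close>)
      from fourier_gauss_on_line[OF u \<alpha> C h decay _ D elim(2) this, of y2] s show ?case
        by (simp add: \<beta>_def norm_Pair mult.commute)
    qed
  qed (intro continuous_intros continuous_on_compose2[OF cont]; simp)+
  have F: "fourier u y = fourier u 0 * of_real (exp (- \<beta> * (norm y)\<^sup>2))" for y
  proof -
    have "fourier u y = of_real (exp (- \<beta> * (s * snd y)\<^sup>2)) * (of_real (exp (- \<beta> * (fst y)\<^sup>2)) * fourier u 0)"
      using 2[of "fst y" "s * snd y"] 1[of "fst y" 0] ss by (simp add: zero_prod_def flip: mult.assoc)
    also have "(s * snd y)\<^sup>2 = (snd y)\<^sup>2" using ss by (simp add: power_mult_distrib power2_eq_square)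
    also have "of_real (exp (- \<beta> * (snd y)\<^sup>2)) * (of_real (exp (- \<beta> * (fst y)\<^sup>2)) * fourier u 0)
        = fourier u 0 * of_real (exp (- \<beta> * (fst y)\<^sup>2) * exp (- \<beta> * (snd y)\<^sup>2))"
      by (simp only: of_real_mult mult_ac)
    also have "exp (- \<beta> * (fst y)\<^sup>2) * exp (- \<beta> * (snd y)\<^sup>2) = exp (- \<beta> * (norm y)\<^sup>2)"
      by (simp add: norm_prod_sq algebra_simps flip: exp_add)
    finally show ?thesis .
  qed
  \<comment> \<open>The Gaussian has transform \<open>pi / \<alpha>\<close> at 0, so this multiple
    of it has the same transform as \<open>u\<close>.\<close>
  define c where "c = fourier u 0 * of_real (\<alpha> / pi)"
  let ?G = "\<lambda>x::real \<times> real. complex_of_real (exp (- \<alpha> * (norm x)\<^sup>2))"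
  have G: "integrable lborel (\<lambda>x. - c * ?G x)" using integrable_gauss[OF \<alpha>] by (intro integrable_mult_right) simp
  have "AE x in lborel. u x + - c * ?G x = 0"
  proof (rule fourier_injective_2d)
    show "integrable lborel (\<lambda>x. u x + - c * ?G x)" using u G by (rule Bochner_Integration.integrable_add)
    fix y
    have "fourier (\<lambda>x. u x + - c * ?G x) y = fourier u y + - c * of_real (pi / \<alpha> * exp (- \<beta> * (norm y)\<^sup>2))"
      unfolding fourier_add[OF u G] fourier_mult_left fourier_gauss[OF \<alpha>] \<beta>_def ..
    also have "\<dots> = 0" using \<alpha> unfolding F[of y] by (simp add: c_def)
    finally show "fourier (\<lambda>x. u x + - c * ?G x) y = 0" .
  qed
  then have "AE x in lborel. u x = c * ?G x" by eventually_elim simp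
  then show ?thesis by blast
qed

subsection \<open>Quaternion-valued functions\<close>

text \<open>The real-linear map \<open>\<phi>\<close> from the complex numbers that sends
  \<open>\<i>\<close> to \<open>q\<close> is a continuous algebra homomorphism and therefore
  commutes with the exponential series.\<close>

lemma exp_imaginary_unit:
  fixes q :: "'a::{real_normed_algebra_1, banach}"
  assumes q: "q * q = -1"
  shows "exp (t *\<^sub>R q) = cos t *\<^sub>R 1 + sin t *\<^sub>R q"
proof -
  define \<phi> where "\<phi> = (\<lambda>z. Re z *\<^sub>R 1 + Im z *\<^sub>R q)"
  have lin: "bounded_linear \<phi>"
    unfolding \<phi>_def
    by (intro bounded_linear_add bounded_linear_scaleR_left[THEN bounded_linear_compose]
        bounded_linear_Re bounded_linear_Im)
  have mult: "\<phi> (z * w) = \<phi> z * \<phi> w" for z w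
    by (simp add: \<phi>_def algebra_simps q)
  have power: "\<phi> (z ^ n) = \<phi> z ^ n" for z n
    by (induction n) (simp_all add: mult, simp add: \<phi>_def)
  have "exp (\<phi> z) = \<phi> (exp z)" for z
    unfolding exp_def bounded_linear.suminf[OF lin summable_exp_generic]
    using lin by (simp add: power linear_simps)
  from this[of "\<i> * t"] show ?thesis
    by (simp add: \<phi>_def flip: cis_conv_exp)
qed

definition quat_of_complex :: "complex \<Rightarrow> quat" where
  "quat_of_complex z = Quat (Re z) (Im z) 0 0"

text \<open>
  For complex \<open>z\<close>, \<open>z (1 + k) j = - i z (1 + k)\<close> and \<open>z (1 - k) j = i z (1 - k)\<close>. In the
  coordinates \<open>q = split_pos q (1 + k) + split_neg q (1 - k)\<close> both kernels of the two-sided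
  transform therefore act as complex scalars from the left.
\<close>

definition split_pos :: "quat \<Rightarrow> complex" where
  "split_pos q = Complex ((Q0 q + Q3 q) / 2) ((Q1 q - Q2 q) / 2)"

definition split_neg :: "quat \<Rightarrow> complex" where
  "split_neg q = Complex ((Q0 q - Q3 q) / 2) ((Q1 q + Q2 q) / 2)"

lemma quat_split: "q = quat_of_complex (split_pos q) * (1 + qk) + quat_of_complex (split_neg q) * (1 - qk)"
  by (simp add: quat_eq_iff quat_of_complex_def split_pos_def split_neg_def qk_def field_simps)

lemma exp_qi: "exp (- (a *\<^sub>R qi)) = cos a *\<^sub>R 1 - sin a *\<^sub>R qi"
  using exp_imaginary_unit[of qi "- a"] by (simp add: quat_units)

lemma exp_qj: "exp (- (b *\<^sub>R qj)) = cos b *\<^sub>R 1 - sin b *\<^sub>R qj"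
  using exp_imaginary_unit[of qj "- b"] by (simp add: quat_units)

text \<open>Left multiplication by \<open>exp (- a i)\<close> acts as \<open>cis (- a)\<close>.
  Moving \<open>exp (- b j)\<close> leftwards past \<open>1 + k\<close> or \<open>1 - k\<close>
  turns it into \<open>cis b\<close> or \<open>cis (- b)\<close>.\<close>

lemma split_kernel:
  shows "split_pos (exp (- (a *\<^sub>R qi)) * q * exp (- (b *\<^sub>R qj))) = split_pos q * cis (- (a - b))"
    and "split_neg (exp (- (a *\<^sub>R qi)) * q * exp (- (b *\<^sub>R qj))) = split_neg q * cis (- (a + b))"
proof -
  have c: "cis (- (a - b)) = Complex (cos a * cos b + sin a * sin b) (cos a * sin b - sin a * cos b)"
    "cis (- (a + b)) = Complex (cos a * cos b - sin a * sin b) (- (sin a * cos b + cos a * sin b))"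
    unfolding cis_cnj[symmetric] by (simp_all add: complex_eq_iff sin_add cos_add sin_diff cos_diff)
  show "split_pos (exp (- (a *\<^sub>R qi)) * q * exp (- (b *\<^sub>R qj))) = split_pos q * cis (- (a - b))"
    unfolding exp_qi exp_qj c by (simp add: split_pos_def complex_eq_iff qi_def qj_def field_simps)
  show "split_neg (exp (- (a *\<^sub>R qi)) * q * exp (- (b *\<^sub>R qj))) = split_neg q * cis (- (a + b))"
    unfolding exp_qi exp_qj c by (simp add: split_neg_def complex_eq_iff qi_def qj_def field_simps)
qed

text \<open>Lets both components inherit the weighted conditions; in fact the squared norm of
  \<open>q\<close> is twice the sum of the squared moduli of its components.\<close>

lemma norm_split_le: "cmod (split_pos q) \<le> norm q" "cmod (split_neg q) \<le> norm q"
proof -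
  have le: "(x + y)\<^sup>2 \<le> 2 * (x\<^sup>2 + y\<^sup>2)" "(x - y)\<^sup>2 \<le> 2 * (x\<^sup>2 + y\<^sup>2)" for x y :: real
    using zero_le_power2[of "x - y"] zero_le_power2[of "x + y"] by (auto simp: power2_sum power2_diff)
  have half: "x / 4 + y / 4 \<le> a + b + c + d" if "x \<le> 2 * (a + d)" "y \<le> 2 * (b + c)" "a \<ge> 0" "b \<ge> 0" "c \<ge> 0" "d \<ge> 0"
    for x y a b c d :: real
    using that by simp
  have "(Q0 q + Q3 q)\<^sup>2 / 4 + (Q1 q - Q2 q)\<^sup>2 / 4 \<le> (Q0 q)\<^sup>2 + (Q1 q)\<^sup>2 + (Q2 q)\<^sup>2 + (Q3 q)\<^sup>2"
    "(Q0 q - Q3 q)\<^sup>2 / 4 + (Q1 q + Q2 q)\<^sup>2 / 4 \<le> (Q0 q)\<^sup>2 + (Q1 q)\<^sup>2 + (Q2 q)\<^sup>2 + (Q3 q)\<^sup>2"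
    by (intro half le zero_le_power2)+
  then show "cmod (split_pos q) \<le> norm q" "cmod (split_neg q) \<le> norm q"
    by (simp_all add: split_pos_def split_neg_def cmod_def norm_quat_def power_divide)
qed

lemma bounded_linear_split: "bounded_linear split_pos" "bounded_linear split_neg"
proof -
  show "bounded_linear split_pos"
    by (rule bounded_linear_intro[where K = 1])
      (use norm_split_le in \<open>auto simp: split_pos_def complex_eq_iff field_simps\<close>)
  show "bounded_linear split_neg"
    by (rule bounded_linear_intro[where K = 1])
      (use norm_split_le in \<open>auto simp: split_neg_def complex_eq_iff field_simps\<close>)
qed

section \<open>The two-sided transform in complex coordinates\<close>

lemma Lr_quat_1_integrable: "f \<in> Lr_quat 1 \<Longrightarrow> integrable lebesgue f"
  by (auto simp: Lr_quat_def intro!: integrableI_bounded)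

text \<open>Being bounded and linear, \<open>T\<close> passes under the integral, where by
  \<open>kernel\<close> the two exponentials together act on the component as one scalar character.
  The function \<open>u\<close> is a Borel representative of that component, which takes the
  integral from \<open>lebesgue\<close> to \<open>lborel\<close>.\<close>

lemma bounded_linear_qft:
  assumes f: "integrable lebesgue f" and u [measurable]: "u \<in> borel_measurable lborel"
    and T: "bounded_linear T" and ae: "AE x in lborel. T (f x) = u x"
    and kernel: "\<And>x. T (exp (- ((2 * pi * fst \<xi> * fst x) *\<^sub>R qi)) * f x * exp (- ((2 * pi * snd \<xi> * snd x) *\<^sub>R qj)))
      = T (f x) * cis (- 2 * pi * (x \<bullet> \<eta>))"
  shows "T (qft f \<xi>) = fourier u \<eta>"
proof -
  let ?K = "\<lambda>x. exp (- ((2 * pi * fst \<xi> * fst x) *\<^sub>R qi)) * f x * exp (- ((2 * pi * snd \<xi> * snd x) *\<^sub>R qj))"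
  have [measurable]: "f \<in> borel_measurable lebesgue" using f by simp
  have [measurable]: "(\<lambda>x::real \<times> real. exp (- ((2 * pi * fst \<xi> * fst x) *\<^sub>R qi))) \<in> borel_measurable lebesgue"
    "(\<lambda>x::real \<times> real. exp (- ((2 * pi * snd \<xi> * snd x) *\<^sub>R qj))) \<in> borel_measurable lebesgue"
    unfolding exp_qi exp_qj
    by (intro measurable_completion, simp, intro borel_measurable_continuous_onI continuous_intros)+
  have [measurable]: "(\<lambda>x. x \<bullet> \<eta>) \<in> borel_measurable borel"
    by (intro borel_measurable_continuous_onI continuous_intros)
  have [measurable]: "T \<in> borel_measurable borel"
    by (intro borel_measurable_continuous_onI bounded_linear.continuous_on[OF T] continuous_intros)
  have K: "integrable lebesgue ?K"
  proof (rule Bochner_Integration.integrable_bound[OF f])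
    have "norm (exp (- (t *\<^sub>R qi))) = 1" "norm (exp (- (t *\<^sub>R qj))) = 1" for t
      unfolding exp_qi exp_qj by (simp_all add: qi_def qj_def norm_quat_def)
    then show "AE x in lebesgue. norm (?K x) \<le> norm (f x)" by (simp add: norm_mult)
  qed measurable
  have m: "(\<lambda>x. T (?K x)) \<in> borel_measurable lebesgue" by measurable
  have m': "(\<lambda>x. u x * cis (- 2 * pi * (x \<bullet> \<eta>))) \<in> borel_measurable lborel" by measurable
  have ae': "AE x in lebesgue. T (?K x) = u x * cis (- 2 * pi * (x \<bullet> \<eta>))"
    unfolding AE_completion_iff kernel using ae by eventually_elim simp
  have "T (qft f \<xi>) = (LINT x|lebesgue. T (?K x))"
    unfolding qft_def by (rule integral_bounded_linear[OF T K, symmetric])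
  also have "\<dots> = (LINT x|lebesgue. u x * cis (- 2 * pi * (x \<bullet> \<eta>)))"
    by (rule integral_cong_AE[OF m measurable_completion[OF m'] ae'])
  also have "\<dots> = fourier u \<eta>"
    unfolding fourier_def by (rule integral_completion[OF m'])
  finally show ?thesis .
qed

text \<open>The phases \<open>a - b\<close> and \<open>a + b\<close> of \<open>split_kernel\<close>
  account for the reflected second frequency with \<open>split_pos\<close> and the unreflected one
  with \<open>split_neg\<close>.\<close>

lemma split_qft:
  assumes f: "integrable lebesgue f" and u: "u \<in> borel_measurable lborel"
  shows split_pos_qft: "(AE x in lborel. split_pos (f x) = u x) \<Longrightarrow> split_pos (qft f \<xi>) = fourier u (fst \<xi>, - snd \<xi>)"
    and split_neg_qft: "(AE x in lborel. split_neg (f x) = u x) \<Longrightarrow> split_neg (qft f \<xi>) = fourier u \<xi>"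
proof -
  show "split_pos (qft f \<xi>) = fourier u (fst \<xi>, - snd \<xi>)" if "AE x in lborel. split_pos (f x) = u x"
    by (rule bounded_linear_qft[OF f u bounded_linear_split(1) that], unfold split_kernel)
      (simp add: inner_prod_def algebra_simps)
  show "split_neg (qft f \<xi>) = fourier u \<xi>" if "AE x in lborel. split_neg (f x) = u x"
    by (rule bounded_linear_qft[OF f u bounded_linear_split(2) that], unfold split_kernel)
      (simp add: inner_prod_def algebra_simps)
qed

section \<open>Weighted conditions and the critical case for quaternions\<close>

lemma enn2real_ge_1: "1 \<le> (p::ennreal) \<Longrightarrow> p \<noteq> \<infinity> \<Longrightarrow> enn2real p \<ge> 1"
  by (cases p) (auto simp: ennreal_le_1 ennreal_1[symmetric] simp del: ennreal_1)

text \<open>For finite \<open>p\<close>, \<open>t \<le> 1 + t\<^sup>p\<close>; this bound stands in for Hoelder's inequality.\<close>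

lemma gauss_weighted_Lp_bound:
  fixes w :: "real \<times> real \<Rightarrow> complex"
  assumes g: "gauss_weighted_Lp c p g" and p: "1 \<le> p"
    and w [measurable]: "w \<in> borel_measurable lborel"
    and le: "AE x in lborel. cmod (w x) \<le> norm (g x)"
  obtains C h where "C \<ge> 0" "integrable lborel h"
    "AE x in lborel. cmod (w x) * exp (c * (norm x)\<^sup>2) \<le> C + h x"
proof (cases "p = \<infinity>")
  case True
  then obtain C where "AE x in lborel. norm (g x) * exp (c * (norm x)\<^sup>2) \<le> C"
    using g by (auto simp: gauss_weighted_Lp_def AE_completion_iff)
  with le have "AE x in lborel. cmod (w x) * exp (c * (norm x)\<^sup>2) \<le> max 0 C + 0"
  proof eventually_elim
    case (elim x)
    have "cmod (w x) * exp (c * (norm x)\<^sup>2) \<le> norm (g x) * exp (c * (norm x)\<^sup>2)"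
      using elim by (intro mult_right_mono) auto
    also have "\<dots> \<le> max 0 C + 0" using elim by simp
    finally show ?case .
  qed
  then show ?thesis by (intro that[of "max 0 C" "\<lambda>_. 0"]) auto
next
  case False
  define r where "r = enn2real p"
  have r: "r \<ge> 1" unfolding r_def using p False by (rule enn2real_ge_1)
  define h where "h = (\<lambda>x. (cmod (w x) * exp (c * (norm x)\<^sup>2)) powr r)"
  have [measurable]: "(\<lambda>x::real \<times> real. exp (c * (norm x)\<^sup>2)) \<in> borel_measurable borel"
    by (intro borel_measurable_continuous_onI continuous_intros)
  have hm [measurable]: "h \<in> borel_measurable lborel" unfolding h_def using w by measurable
  have "(\<integral>\<^sup>+x. ennreal (h x) \<partial>lborel) = (\<integral>\<^sup>+x. ennreal (h x) \<partial>lebesgue)"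
    by (rule nn_integral_completion[symmetric])
  also have "\<dots> \<le> (\<integral>\<^sup>+x. ennreal ((norm (g x) * exp (c * (norm x)\<^sup>2)) powr r) \<partial>lebesgue)"
  proof (rule nn_integral_mono_AE)
    show "AE x in lebesgue. ennreal (h x) \<le> ennreal ((norm (g x) * exp (c * (norm x)\<^sup>2)) powr r)"
      using le unfolding AE_completion_iff h_def
    proof eventually_elim
      case (elim x)
      then show ?case using r by (intro ennreal_leI powr_mono2 mult_right_mono) auto
    qed
  qed
  also have "\<dots> < \<infinity>" using g False by (simp add: gauss_weighted_Lp_def r_def)
  finally have "integrable lborel h"
    by (intro integrableI_bounded) (auto simp: h_def)
  moreover have "t \<le> 1 + t powr r" if "t \<ge> 0" for t
  proof (cases "t \<le> 1")
    case False
    then have "t powr 1 \<le> t powr r" using r by (intro powr_mono) auto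
    then show ?thesis using False by simp
  qed (simp add: add_increasing2)
  ultimately show ?thesis
    by (intro that[of 1 h]) (auto simp: h_def)
qed

lemma gauss_weighted_Lp_mono:
  assumes "gauss_weighted_Lp c p g" "1 \<le> p" "c' \<le> c"
  shows "gauss_weighted_Lp c' p g"
proof -
  have le: "norm (g x) * exp (c' * (norm x)\<^sup>2) \<le> norm (g x) * exp (c * (norm x)\<^sup>2)" for x
    using assms(3) by (intro mult_left_mono) (auto intro: mult_right_mono)
  show ?thesis
  proof (cases "p = \<infinity>")
    case True
    then obtain C where "AE x in lebesgue. norm (g x) * exp (c * (norm x)\<^sup>2) \<le> C"
      using assms by (auto simp: gauss_weighted_Lp_def)
    then have "AE x in lebesgue. norm (g x) * exp (c' * (norm x)\<^sup>2) \<le> C"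
      by eventually_elim (use le order_trans in blast)
    then show ?thesis using True by (auto simp: gauss_weighted_Lp_def)
  next
    case False
    have "enn2real p \<ge> 1" using assms(2) False by (rule enn2real_ge_1)
    then have "(\<integral>\<^sup>+x. ennreal ((norm (g x) * exp (c' * (norm x)\<^sup>2)) powr enn2real p) \<partial>lebesgue)
        \<le> (\<integral>\<^sup>+x. ennreal ((norm (g x) * exp (c * (norm x)\<^sup>2)) powr enn2real p) \<partial>lebesgue)"
      using le by (intro nn_integral_mono ennreal_leI powr_mono2) auto
    also have "\<dots> < \<infinity>" using assms(1) False by (simp add: gauss_weighted_Lp_def)
    finally show ?thesis using False by (simp add: gauss_weighted_Lp_def)
  qed
qed

lemma completion_ex_borel_measurable_complex:
  fixes g :: "'a \<Rightarrow> complex"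
  assumes [measurable]: "g \<in> borel_measurable (completion M)"
  obtains u where "u \<in> borel_measurable M" "AE x in M. g x = u x"
proof -
  obtain a where a [measurable]: "a \<in> borel_measurable M" "AE x in M. Re (g x) = a x"
    using completion_ex_borel_measurable_real[of "\<lambda>x. Re (g x)" M] by auto
  obtain b where b [measurable]: "b \<in> borel_measurable M" "AE x in M. Im (g x) = b x"
    using completion_ex_borel_measurable_real[of "\<lambda>x. Im (g x)" M] by auto
  show ?thesis
  proof (rule that)
    have "(\<lambda>x. of_real (a x) + \<i> * of_real (b x)) \<in> borel_measurable M" by measurable
    then show "(\<lambda>x. Complex (a x) (b x)) \<in> borel_measurable M" by (simp add: Complex_eq)
    show "AE x in M. g x = Complex (a x) (b x)"
      using a(2) b(2) by eventually_elim (simp add: complex_eq_iff)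
  qed
qed

text \<open>Common argument for the two components: \<open>T\<close> is \<open>split_pos\<close>
  with \<open>s = -1\<close> or \<open>split_neg\<close> with \<open>s = 1\<close>. Both weighted
  conditions pass to the component because \<open>T\<close> does not increase the norm.\<close>

lemma hardy_component:
  assumes \<alpha>: "\<alpha> > 0" and p: "1 \<le> p" and q: "1 \<le> q" and f: "f \<in> Lr_quat 1"
    and fp: "gauss_weighted_Lp \<alpha> p f" and Fq: "gauss_weighted_Lp (pi\<^sup>2 / \<alpha>) q (qft f)"
    and T: "bounded_linear T" "\<And>x. cmod (T x) \<le> norm x" and s: "\<bar>s\<bar> = 1"
    and Tq: "\<And>u \<xi>. u \<in> borel_measurable lborel \<Longrightarrow> (AE x in lborel. T (f x) = u x) \<Longrightarrow>
      T (qft f \<xi>) = fourier u (fst \<xi>, s * snd \<xi>)"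
  shows "\<exists>c. AE x in lborel. T (f x) = c * of_real (exp (- \<alpha> * (norm x)\<^sup>2))"
proof -
  have fi: "integrable lebesgue f" using f by (rule Lr_quat_1_integrable)
  have Tf: "integrable lebesgue (\<lambda>x. T (f x))"
    by (rule integrable_bounded_linear[OF T(1) fi])
  obtain u where u [measurable]: "u \<in> borel_measurable lborel" and ae: "AE x in lborel. T (f x) = u x"
    using completion_ex_borel_measurable_complex[of "\<lambda>x. T (f x)" lborel] Tf by auto
  have "integrable lebesgue u"
    using Tf ae by (subst integrable_cong_AE[of u _ "\<lambda>x. T (f x)"]) (auto simp: AE_completion_iff measurable_completion)
  then have ui: "integrable lborel u" using u by (simp add: integrable_completion)
  note Tq = Tq[OF u ae]
  have "AE x in lborel. cmod (u x) \<le> norm (f x)"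
    using ae by eventually_elim (metis T(2))
  from gauss_weighted_Lp_bound[OF fp p u this] obtain C h where
    C: "C \<ge> 0" "integrable lborel h" "AE x in lborel. cmod (u x) * exp (\<alpha> * (norm x)\<^sup>2) \<le> C + h x" .
  let ?w = "\<lambda>y. fourier u (fst y, s * snd y)"
  have w: "?w \<in> borel_measurable lborel"
    by (simp, intro borel_measurable_continuous_onI continuous_on_compose2[OF continuous_on_fourier[OF ui]]
      continuous_intros) auto
  have "AE y in lborel. cmod (?w y) \<le> norm (qft f y)" by (simp flip: Tq add: T(2))
  from gauss_weighted_Lp_bound[OF Fq q w this] obtain D k where
    D: "D \<ge> 0" "integrable lborel k" "AE y in lborel. cmod (?w y) * exp (pi\<^sup>2 / \<alpha> * (norm y)\<^sup>2) \<le> D + k y" .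
  obtain c where "AE x in lborel. u x = c * of_real (exp (- \<alpha> * (norm x)\<^sup>2))"
    using hardy_complex[OF ui \<alpha> C D(1,2) s D(3)] by blast
  with ae have "AE x in lborel. T (f x) = c * of_real (exp (- \<alpha> * (norm x)\<^sup>2))"
    by eventually_elim simp
  then show ?thesis by blast
qed

lemma quat_of_complex_mult_of_real: "quat_of_complex (c * of_real r) = quat_of_complex c * of_real r"
  by (simp add: quat_eq_iff quat_of_complex_def of_real_def)

lemma of_real_commute_quat: "of_real r * (q :: quat) = q * of_real r"
  by (simp add: of_real_def)

text \<open>Both components are multiples of the same real Gaussian, which commutes with all
  quaternions, so the splitting reassembles them with a single coefficient on the left.\<close>

lemma hardy_quat:
  assumes \<alpha>: "\<alpha> > 0" and p: "1 \<le> p" and q: "1 \<le> q" and f: "f \<in> Lr_quat 1"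
    and fp: "gauss_weighted_Lp \<alpha> p f" and Fq: "gauss_weighted_Lp (pi\<^sup>2 / \<alpha>) q (qft f)"
  shows "\<exists>c::quat. AE x in lebesgue. f x = c * of_real (exp (- \<alpha> * (norm x)\<^sup>2))"
proof -
  note fi = Lr_quat_1_integrable[OF f]
  obtain a where a: "AE x in lborel. split_pos (f x) = a * of_real (exp (- \<alpha> * (norm x)\<^sup>2))"
    using hardy_component[OF \<alpha> p q f fp Fq bounded_linear_split(1) norm_split_le(1), of "-1"] split_pos_qft[OF fi]
    by auto
  obtain b where b: "AE x in lborel. split_neg (f x) = b * of_real (exp (- \<alpha> * (norm x)\<^sup>2))"
    using hardy_component[OF \<alpha> p q f fp Fq bounded_linear_split(2) norm_split_le(2), of 1] split_neg_qft[OF fi]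
    by auto
  have "AE x in lebesgue. f x = (quat_of_complex a * (1 + qk) + quat_of_complex b * (1 - qk)) * of_real (exp (- \<alpha> * (norm x)\<^sup>2))"
    using a b unfolding AE_completion_iff
  proof eventually_elim
    case (elim x)
    show ?case
      by (subst quat_split) (simp only: elim quat_of_complex_mult_of_real distrib_right mult.assoc of_real_commute_quat)
  qed
  then show ?thesis by blast
qed

section \<open>Linearly independent Gaussians\<close>

text \<open>Multiplying by \<open>exp (m * t)\<close>, with \<open>m\<close> the smallest rate, and
  letting \<open>t\<close> tend to infinity isolates \<open>b m\<close>; induction then handles the
  larger rates.\<close>

lemma exp_lin_indep:
  fixes b :: "real \<Rightarrow> 'a::real_normed_vector"
  assumes "finite I" "\<And>t. t \<ge> 0 \<Longrightarrow> (\<Sum>c\<in>I. exp (- c * t) *\<^sub>R b c) = 0"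
  shows "\<forall>c\<in>I. b c = 0"
  using assms
proof (induction I rule: finite_linorder_min_induct)
  case (insert m A)
  have "((\<lambda>t. (\<Sum>c\<in>insert m A. exp (- (c - m) * t) *\<^sub>R b c)) \<longlongrightarrow> (\<Sum>c\<in>insert m A. (if c = m then 1 else 0) *\<^sub>R b c)) at_top"
  proof (intro tendsto_sum tendsto_scaleR tendsto_const)
    fix c assume "c \<in> insert m A"
    then have "c = m \<or> c > m" using insert by auto
    then show "((\<lambda>t. exp (- (c - m) * t)) \<longlongrightarrow> (if c = m then 1 else 0)) at_top"
    proof
      assume "c > m"
      then have "filterlim (\<lambda>t. - (c - m) * t) at_bot at_top"
        by (intro filterlim_tendsto_neg_mult_at_bot[OF tendsto_const] filterlim_ident) auto
      then show ?thesis using \<open>c > m\<close> by (auto intro: filterlim_compose[OF exp_at_bot])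
    qed simp
  qed
  moreover have "eventually (\<lambda>t. (\<Sum>c\<in>insert m A. exp (- (c - m) * t) *\<^sub>R b c) = 0) at_top"
    using eventually_ge_at_top[of 0]
  proof eventually_elim
    case (elim t)
    have "(\<Sum>c\<in>insert m A. exp (- (c - m) * t) *\<^sub>R b c) = exp (m * t) *\<^sub>R (\<Sum>c\<in>insert m A. exp (- c * t) *\<^sub>R b c)"
      unfolding scaleR_sum_right by (intro sum.cong) (auto simp: algebra_simps simp flip: exp_add)
    then show ?case using insert.prems[OF elim] by simp
  qed
  ultimately have "((\<lambda>t. 0) \<longlongrightarrow> (\<Sum>c\<in>insert m A. (if c = m then 1 else 0) *\<^sub>R b c)) (at_top :: real filter)"
    by (rule Lim_transform_eventually)
  then have "(\<Sum>c\<in>insert m A. (if c = m then 1 else 0) *\<^sub>R b c) = 0"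
    by (simp add: tendsto_const_iff)
  then have bm: "b m = 0" using insert by (simp add: sum.delta if_distrib[of "\<lambda>r. r *\<^sub>R _"] cong: if_cong)
  have "(\<Sum>c\<in>A. exp (- c * t) *\<^sub>R b c) = 0" if "t \<ge> 0" for t
    using insert.prems[OF that] insert.hyps bm by (subst (asm) sum.insert) auto
  then show ?case using insert.IH bm by simp
qed simp

definition gauss_quat :: "real \<Rightarrow> real \<times> real \<Rightarrow> quat" where
  "gauss_quat c x = of_real (exp (- c * (norm x)\<^sup>2))"

lemma gauss_quat_measurable [measurable]: "gauss_quat c \<in> borel_measurable borel"
  unfolding gauss_quat_def by (intro borel_measurable_continuous_onI continuous_intros)

text \<open>Weight and Gaussian combine to a Gaussian of positive rate \<open>c - a\<close>. Only
  the modulus of \<open>g\<close> is prescribed, up to a factor \<open>B\<close>, so that the lemma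
  serves both \<open>gauss_quat c\<close> and its transform.\<close>

lemma gauss_weighted_Lp_gauss:
  assumes g: "\<And>x. norm (g x) = B * exp (- c * (norm x)\<^sup>2)" and "a < c" and p: "1 \<le> p" and B: "B \<ge> 0"
  shows "gauss_weighted_Lp a p g"
proof -
  have eq: "norm (g x) * exp (a * (norm x)\<^sup>2) = B * exp (- (c - a) * (norm x)\<^sup>2)" for x
    unfolding g by (simp add: algebra_simps flip: exp_add)
  show ?thesis
  proof (cases "p = \<infinity>")
    case True
    have "norm (g x) * exp (a * (norm x)\<^sup>2) \<le> B" for x
      unfolding eq using \<open>a < c\<close> B by (intro mult_left_le) (auto intro: mult_nonpos_nonneg)
    then have "AE x in lebesgue. norm (g x) * exp (a * (norm x)\<^sup>2) \<le> B" by (rule AE_I2)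
    then show ?thesis using True by (auto simp: gauss_weighted_Lp_def)
  next
    case False
    define r where "r = enn2real p"
    have r: "r \<ge> 1" unfolding r_def using p False by (rule enn2real_ge_1)
    have eqr: "(norm (g x) * exp (a * (norm x)\<^sup>2)) powr r = B powr r * exp (- ((c - a) * r) * (norm x)\<^sup>2)" for x
      unfolding eq using B by (simp add: powr_mult exp_powr_real algebra_simps)
    have "integrable lborel (\<lambda>x::real \<times> real. B powr r * exp (- ((c - a) * r) * (norm x)\<^sup>2))"
      using \<open>a < c\<close> r by (intro integrable_mult_right integrable_gauss) auto
    then have "(\<integral>\<^sup>+x. ennreal ((norm (g x) * exp (a * (norm x)\<^sup>2)) powr r) \<partial>lborel) < \<infinity>"
      unfolding eqr integrable_iff_bounded by simp
    then show ?thesis using False by (simp add: gauss_weighted_Lp_def nn_integral_completion r_def)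
  qed
qed

text \<open>With weight exponent 0 the weighted condition reduces to plain integrability of the
  \<open>r\<close>-th power.\<close>

lemma gauss_quat_Lr:
  assumes "c > 0" "r \<ge> 1"
  shows "gauss_quat c \<in> Lr_quat r"
proof -
  have "gauss_weighted_Lp 0 (ennreal r) (gauss_quat c)"
    using assms by (intro gauss_weighted_Lp_gauss[of _ 1 c]) (auto simp: gauss_quat_def)
  then show ?thesis
    using assms by (auto simp: Lr_quat_def gauss_weighted_Lp_def measurable_completion)
qed

text \<open>Both components of a real quaternion equal half of it, and the transform of the Gaussian
  is even in each frequency, so the reflection in \<open>split_pos_qft\<close> is invisible and the
  components recombine to a real value.\<close>

lemma qft_gauss_quat:
  assumes c: "c > 0"
  shows "qft (gauss_quat c) \<xi> = of_real (pi / c * exp (- (pi\<^sup>2 / c) * (norm \<xi>)\<^sup>2))"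
proof -
  let ?u = "\<lambda>x::real \<times> real. 1 / 2 * complex_of_real (exp (- c * (norm x)\<^sup>2))"
  let ?r = "pi / c * exp (- (pi\<^sup>2 / c) * (norm \<xi>)\<^sup>2)"
  have i: "integrable lebesgue (gauss_quat c)" using gauss_quat_Lr[OF c, of 1] by (intro Lr_quat_1_integrable) simp
  have "?u \<in> borel_measurable borel" by (intro borel_measurable_continuous_onI continuous_intros)
  then have u: "?u \<in> borel_measurable lborel" by simp
  have s: "split_pos (of_real r) = 1 / 2 * of_real r" "split_neg (of_real r) = 1 / 2 * of_real r" for r
    by (simp_all add: split_pos_def split_neg_def complex_eq_iff of_real_def)
  have "split_pos (qft (gauss_quat c) \<xi>) = fourier ?u (fst \<xi>, - snd \<xi>)"
    by (rule split_pos_qft[OF i u]) (simp add: gauss_quat_def s)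
  moreover have "split_neg (qft (gauss_quat c) \<xi>) = fourier ?u \<xi>"
    by (rule split_neg_qft[OF i u]) (simp add: gauss_quat_def s)
  ultimately have "split_pos (qft (gauss_quat c) \<xi>) = split_pos (of_real ?r)" "split_neg (qft (gauss_quat c) \<xi>) = split_neg (of_real ?r)"
    unfolding s fourier_mult_left fourier_gauss[OF c] by (simp_all add: norm_prod_sq)
  then show ?thesis
    using quat_split[of "qft (gauss_quat c) \<xi>"] quat_split[of "of_real ?r"] by simp
qed

lemma gauss_quat_inj: "inj gauss_quat"
proof (rule injI)
  fix c d assume "gauss_quat c = gauss_quat d"
  then have "gauss_quat c (1, 0) = gauss_quat d (1, 0)" by simp
  then show "c = d" by (simp add: gauss_quat_def norm_Pair)
qed

text \<open>Gaussians are real valued, so left and right quaternion coefficients give the same sums.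
  These are radial, and with \<open>t = |x|^2\<close> they become the exponential sums of
  \<open>exp_lin_indep\<close>.\<close>

lemma gauss_quat_lin_indep:
  shows "left_lin_indep_ae (gauss_quat ` J)" "right_lin_indep_ae (gauss_quat ` J)"
proof -
  have *: "\<forall>g\<in>T. a g = 0"
    if T: "finite T" "T \<subseteq> gauss_quat ` J"
      and ae: "AE x in lebesgue. (\<Sum>g\<in>T. Q0 (g x) *\<^sub>R a g) = 0" for T and a :: "_ \<Rightarrow> quat"
  proof -
    obtain I where I: "finite I" "T = gauss_quat ` I" using finite_subset_image[OF T] by blast
    have inj: "inj_on gauss_quat I" using gauss_quat_inj by (rule inj_on_subset) simp
    have sum: "(\<Sum>g\<in>T. Q0 (g x) *\<^sub>R a g) = (\<Sum>c\<in>I. exp (- c * (norm x)\<^sup>2) *\<^sub>R a (gauss_quat c))" for x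
      unfolding I(2) sum.reindex[OF inj] by (simp add: gauss_quat_def of_real_def)
    \<comment> \<open>The sum is continuous in \<open>x\<close>, so vanishing almost everywhere
      means vanishing everywhere; the points \<open>(sqrt t, 0)\<close> then realise every
      \<open>t \<ge> 0\<close>.\<close>
    have zero: "(\<Sum>c\<in>I. exp (- c * (norm x)\<^sup>2) *\<^sub>R a (gauss_quat c)) = 0" for x :: "real \<times> real"
    proof (rule AE_lborel_eq_imp_eq[where x = x])
      show "AE x in lborel. (\<Sum>c\<in>I. exp (- c * (norm (x :: real \<times> real))\<^sup>2) *\<^sub>R a (gauss_quat c)) = 0"
        using ae by (simp only: sum AE_completion_iff)
    qed (intro continuous_intros)+
    have "\<forall>c\<in>I. a (gauss_quat c) = 0"
    proof (rule exp_lin_indep[OF I(1)])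
      fix t :: real assume "t \<ge> 0"
      then show "(\<Sum>c\<in>I. exp (- c * t) *\<^sub>R a (gauss_quat c)) = 0"
        using zero[of "(sqrt t, 0)"] by (simp add: norm_Pair)
    qed
    then show ?thesis by (simp add: I(2))
  qed
  have real: "g x = of_real (Q0 (g x))" if "g \<in> gauss_quat ` J" for g x
    using that by (auto simp: gauss_quat_def of_real_def)
  have l: "(\<Sum>g\<in>T. a g * g x) = (\<Sum>g\<in>T. Q0 (g x) *\<^sub>R a g)"
    and r: "(\<Sum>g\<in>T. g x * a g) = (\<Sum>g\<in>T. Q0 (g x) *\<^sub>R a g)" if "T \<subseteq> gauss_quat ` J" for T a x
  proof -
    have "a g * g x = Q0 (g x) *\<^sub>R a g" "g x * a g = Q0 (g x) *\<^sub>R a g" if "g \<in> T" for g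
    proof -
      obtain s where "g x = of_real s" using real[of g] \<open>g \<in> T\<close> \<open>T \<subseteq> _\<close> by blast
      then show "a g * g x = Q0 (g x) *\<^sub>R a g" "g x * a g = Q0 (g x) *\<^sub>R a g" by (simp_all add: of_real_def)
    qed
    then show "(\<Sum>g\<in>T. a g * g x) = (\<Sum>g\<in>T. Q0 (g x) *\<^sub>R a g)" "(\<Sum>g\<in>T. g x * a g) = (\<Sum>g\<in>T. Q0 (g x) *\<^sub>R a g)"
      by (intro sum.cong; simp)+
  qed
  show "left_lin_indep_ae (gauss_quat ` J)"
    unfolding left_lin_indep_ae_def
  proof (intro allI impI)
    fix T a assume T: "finite T" "T \<subseteq> gauss_quat ` J" and "AE x in lebesgue. (\<Sum>g\<in>T. a g * g x) = 0"
    then show "\<forall>g\<in>T. a g = 0" unfolding l[OF T(2)] by (intro *) auto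
  qed
  show "right_lin_indep_ae (gauss_quat ` J)"
    unfolding right_lin_indep_ae_def
  proof (intro allI impI)
    fix T a assume T: "finite T" "T \<subseteq> gauss_quat ` J" and "AE x in lebesgue. (\<Sum>g\<in>T. g x * a g) = 0"
    then show "\<forall>g\<in>T. a g = 0" unfolding r[OF T(2)] by (intro *) auto
  qed
qed

theorem corollary4p5:
  fixes \<alpha> \<beta> :: real and p q :: ennreal
  assumes "\<alpha> > 0" and "\<beta> > 0"
    and "1 \<le> p" and "1 \<le> q" and "min p q < \<infinity>"
  shows "(\<alpha> * \<beta> > pi\<^sup>2 \<longrightarrow>
           (\<forall>f \<in> Lr_quat 1 \<inter> Lr_quat 2.
              gauss_weighted_Lp \<alpha> p f \<and> gauss_weighted_Lp \<beta> q (qft f) \<longrightarrow>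
              (AE x in lebesgue. f x = 0))) \<and>
         (\<alpha> * \<beta> = pi\<^sup>2 \<longrightarrow>
           (\<forall>f \<in> Lr_quat 1 \<inter> Lr_quat 2.
              gauss_weighted_Lp \<alpha> p f \<and> gauss_weighted_Lp \<beta> q (qft f) \<longrightarrow>
              (\<exists>c::quat. AE x in lebesgue. f x = c * of_real (exp (- \<alpha> * (norm x)\<^sup>2))))) \<and>
         (\<alpha> * \<beta> < pi\<^sup>2 \<longrightarrow>
           (\<exists>S. infinite S \<and> S \<subseteq> Lr_quat 1 \<inter> Lr_quat 2 \<and>
              (\<forall>f\<in>S. gauss_weighted_Lp \<alpha> p f \<and> gauss_weighted_Lp \<beta> q (qft f)) \<and>
              left_lin_indep_ae S \<and> right_lin_indep_ae S))"
proof (intro conjI impI ballI)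
  note \<alpha> = assms(1) and \<beta> = assms(2) and p = assms(3) and q = assms(4)
  fix f assume f: "f \<in> Lr_quat 1 \<inter> Lr_quat 2"
    and fw: "gauss_weighted_Lp \<alpha> p f \<and> gauss_weighted_Lp \<beta> q (qft f)"
  {
    assume gt: "\<alpha> * \<beta> > pi\<^sup>2"
    \<comment> \<open>This is the decay rate critical for \<beta>. The first application of
      \<open>hardy_quat\<close> below weakens the condition on the transform, the second the
      condition on \<open>f\<close>.\<close>
    define \<alpha>' where "\<alpha>' = pi\<^sup>2 / \<beta>"
    have \<alpha>': "0 < \<alpha>'" "\<alpha>' < \<alpha>" "pi\<^sup>2 / \<alpha> \<le> \<beta>" "pi\<^sup>2 / \<alpha>' = \<beta>"
      using gt \<alpha> \<beta> by (auto simp: \<alpha>'_def field_simps)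
    obtain c :: quat where c: "AE x in lebesgue. f x = c * of_real (exp (- \<alpha> * (norm x)\<^sup>2))"
      using hardy_quat[OF \<alpha> p q _ _ gauss_weighted_Lp_mono[OF _ q \<alpha>'(3)]] f fw by blast
    obtain d :: quat where d: "AE x in lebesgue. f x = d * of_real (exp (- \<alpha>' * (norm x)\<^sup>2))"
      using hardy_quat[OF \<alpha>'(1) p q _ gauss_weighted_Lp_mono[OF _ p less_imp_le[OF \<alpha>'(2)]]] \<alpha>'(4) f fw by auto
    have eq: "c * of_real (exp (- \<alpha> * (norm x)\<^sup>2)) = d * of_real (exp (- \<alpha>' * (norm x)\<^sup>2))" for x :: "real \<times> real"
    proof (rule AE_lborel_eq_imp_eq[where x = x])
      show "AE x in lborel. c * of_real (exp (- \<alpha> * (norm (x :: real \<times> real))\<^sup>2)) = d * of_real (exp (- \<alpha>' * (norm x)\<^sup>2))"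
        using c d unfolding AE_completion_iff by eventually_elim simp
    qed (intro continuous_intros)+
    \<comment> \<open>At the origin both Gaussians equal 1; at \<open>(1, 0)\<close> they
      differ.\<close>
    have "c = d" using eq[of 0] by simp
    moreover have "exp (- \<alpha>) \<noteq> exp (- \<alpha>')" using \<alpha>'(2) by simp
    ultimately have "c = 0" using eq[of "(1, 0)"] by (auto simp: norm_Pair)
    with c show "AE x in lebesgue. f x = 0" by simp
  }
  {
    assume "\<alpha> * \<beta> = pi\<^sup>2"
    then have "pi\<^sup>2 / \<alpha> = \<beta>" using \<alpha> by (simp add: field_simps)
    then show "\<exists>c::quat. AE x in lebesgue. f x = c * of_real (exp (- \<alpha> * (norm x)\<^sup>2))"
      using hardy_quat[OF \<alpha> p q] f fw by auto
  }
next
  note \<alpha> = assms(1) and \<beta> = assms(2) and p = assms(3) and q = assms(4)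
  assume lt: "\<alpha> * \<beta> < pi\<^sup>2"
  \<comment> \<open>The lower end lets the Gaussian beat the weight on \<open>f\<close>; the upper
    end makes the rate \<open>pi\<^sup>2 / c\<close> of its transform exceed \<beta>.\<close>
  define J where "J = {\<alpha><..<pi\<^sup>2 / \<beta>}"
  have "\<alpha> < pi\<^sup>2 / \<beta>" using lt \<beta> by (simp add: field_simps)
  then have "infinite J" unfolding J_def by (rule infinite_Ioo)
  then have "infinite (gauss_quat ` J)" using gauss_quat_inj by (metis finite_imageD inj_on_subset subset_UNIV)
  moreover have J: "c > 0" "\<alpha> < c" "\<beta> < pi\<^sup>2 / c" if "c \<in> J" for c
    using that \<alpha> \<beta> by (auto simp: J_def field_simps)
  have "gauss_quat ` J \<subseteq> Lr_quat 1 \<inter> Lr_quat 2"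
    using J(1) by (auto intro!: gauss_quat_Lr)
  moreover have "gauss_weighted_Lp \<alpha> p (gauss_quat c)" if "c \<in> J" for c
    using J[OF that] p by (intro gauss_weighted_Lp_gauss[of _ 1 c]) (auto simp: gauss_quat_def)
  moreover have "gauss_weighted_Lp \<beta> q (qft (gauss_quat c))" if "c \<in> J" for c
  proof (rule gauss_weighted_Lp_gauss[of _ "pi / c" "pi\<^sup>2 / c"])
    show "norm (qft (gauss_quat c) x) = pi / c * exp (- (pi\<^sup>2 / c) * (norm x)\<^sup>2)" for x
      unfolding qft_gauss_quat[OF J(1)[OF that]] norm_of_real using J(1)[OF that] by simp
  qed (use J[OF that] q in auto)
  ultimately show "\<exists>S. infinite S \<and> S \<subseteq> Lr_quat 1 \<inter> Lr_quat 2 \<and>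
      (\<forall>f\<in>S. gauss_weighted_Lp \<alpha> p f \<and> gauss_weighted_Lp \<beta> q (qft f)) \<and>
      left_lin_indep_ae S \<and> right_lin_indep_ae S"
    using gauss_quat_lin_indep[of J] by (intro exI[of _ "gauss_quat ` J"]) auto
qed

end
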